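(* A finite $2$-group $G$ has the cut-property if, and only if, for all $x \in G$, $x^{3}$ is conjugate in $G$ to $x$ or to $x^{-1}$. Furthermore, if a finite $2$-group $G$ has the cut-property, then each quotient of successive terms in its lower central series, as well as each quotient of successive terms in its upper central series, is of exponent $2$ or $4$.
   Context: For a finite group $G$, let $\mathcal{U}(\mathbb{Z}[G])$ denote the group of units of the integral group ring $\mathbb{Z}[G]$ and $\mathcal{Z}(\cdot)$ the centre of a group. A finite group $G$ has the cut-property if all central units of $\mathbb{Z}[G]$ are trivial, i.e. $\mathcal{Z}(\mathcal{U}(\mathbb{Z}[G])) = \pm\mathcal{Z}(G) = \{\pm g : g \in \mathcal{Z}(G)\}$. The lower central series of $G$ is written $G = \gamma_1(G) \supset \gamma_2(G) \supset \cdots \supset \gamma_n(G) = \langle 1 \rangle$ and the upper central series is written $\langle 1 \rangle = \mathcal{Z}_0(G) \subset \mathcal{Z}_1(G) \subset \cdots \subset \mathcal{Z}_n(G) = G$; both are strictly monotone and stop when they reach $\langle 1\rangle$, respectively $G$, so the quotients in question are non-trivial. *)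

theory Defs
  imports "HOL-Algebra.Algebra" "HOL-Library.Poly_Mapping"
begin

definition group_centre :: "('a, 'b) monoid_scheme \<Rightarrow> 'a set" where
  "group_centre G = {z \<in> carrier G. \<forall>x \<in> carrier G. z \<otimes>\<^bsub>G\<^esub> x = x \<otimes>\<^bsub>G\<^esub> z}"

definition conjugate_in :: "('a, 'b) monoid_scheme \<Rightarrow> 'a \<Rightarrow> 'a \<Rightarrow> bool" where
  "conjugate_in G x y \<longleftrightarrow> (\<exists>g \<in> carrier G. y = g \<otimes>\<^bsub>G\<^esub> x \<otimes>\<^bsub>G\<^esub> inv\<^bsub>G\<^esub> g)"

text \<open>The formal sum of all \<open>c\<^sub>g g\<close> is the finitely supported function \<open>g \<mapsto> c\<^sub>g\<close>,
  vanishing outside the carrier of \<open>G\<close>; a group element \<open>g\<close> is identified with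
  \<open>Poly_Mapping.single g 1\<close>. The type class multiplication of \<open>poly_mapping\<close> is not used, since
  it convolves over the additive structure of the index type.\<close>

definition integral_group_ring :: "('a, 'b) monoid_scheme \<Rightarrow> ('a \<Rightarrow>\<^sub>0 int) ring" where
  "integral_group_ring G =
    \<lparr>carrier = {c. Poly_Mapping.keys c \<subseteq> carrier G},
     monoid.mult = (\<lambda>a b. \<Sum>g \<in> Poly_Mapping.keys a. \<Sum>h \<in> Poly_Mapping.keys b.
       Poly_Mapping.single (g \<otimes>\<^bsub>G\<^esub> h) (Poly_Mapping.lookup a g * Poly_Mapping.lookup b h)),
     one = Poly_Mapping.single \<one>\<^bsub>G\<^esub> 1,
     ring.zero = 0,
     ring.add = (+)\<rparr>"

definition cut_property :: "('a, 'b) monoid_scheme \<Rightarrow> bool" where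
  "cut_property G \<longleftrightarrow>
    group_centre (units_of (integral_group_ring G)) =
      (\<lambda>g. Poly_Mapping.single g 1) ` group_centre G \<union>
      (\<lambda>g. - Poly_Mapping.single g 1) ` group_centre G"

definition commutator_subgroup :: "('a, 'b) monoid_scheme \<Rightarrow> 'a set \<Rightarrow> 'a set \<Rightarrow> 'a set" where
  "commutator_subgroup G H K =
    generate G {h \<otimes>\<^bsub>G\<^esub> k \<otimes>\<^bsub>G\<^esub> inv\<^bsub>G\<^esub> h \<otimes>\<^bsub>G\<^esub> inv\<^bsub>G\<^esub> k | h k. h \<in> H \<and> k \<in> K}"

text \<open>Indexed from zero: \<open>lower_central G i\<close> is the term usually written \<open>\<gamma>\<^bsub>i+1\<^esub>(G)\<close>.\<close>

primrec lower_central :: "('a, 'b) monoid_scheme \<Rightarrow> nat \<Rightarrow> 'a set" where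
  "lower_central G 0 = carrier G"
| "lower_central G (Suc i) = commutator_subgroup G (lower_central G i) (carrier G)"

text \<open>The term of index \<open>i + 1\<close> is the preimage in \<open>G\<close> of the centre of the quotient of \<open>G\<close>
  by the term of index \<open>i\<close>.\<close>

primrec upper_central :: "('a, 'b) monoid_scheme \<Rightarrow> nat \<Rightarrow> 'a set" where
  "upper_central G 0 = {\<one>\<^bsub>G\<^esub>}"
| "upper_central G (Suc i) =
    {x \<in> carrier G. upper_central G i #>\<^bsub>G\<^esub> x \<in> group_centre (G Mod upper_central G i)}"

text \<open>The value is 0 if no positive exponent exists.\<close>

definition group_exponent :: "('a, 'b) monoid_scheme \<Rightarrow> nat" where
  "group_exponent G =
    (let P = (\<lambda>m::nat. 0 < m \<and> (\<forall>x \<in> carrier G. x [^]\<^bsub>G\<^esub> m = \<one>\<^bsub>G\<^esub>))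
     in if \<exists>m. P m then LEAST m. P m else 0)"

end

theory Submission
  imports Defs
    "Jordan_Normal_Form.Jordan_Normal_Form_Existence"
    "Jordan_Normal_Form.Jordan_Normal_Form_Uniqueness"
begin

text \<open>
  Write \<open>\<zeta>\<close> for a primitive root of unity of order \<open>2\<^sup>m\<close>, a multiple of the exponent of the 2-group \<open>G\<close>.
  The centre of the rational group algebra is a product of subfields of \<open>\<rat>(\<zeta>)\<close>, and every
  automorphism \<open>\<zeta> \<mapsto> \<zeta>\<^sup>j\<close> acts on a sum of character values by replacing each group element by its
  \<open>j\<close>-th power. Central units are governed by the maximal real subfields of these fields. Since the
  odd residues modulo \<open>2\<^sup>m\<close> are generated by \<open>-1\<close> and \<open>3\<close>, a real subfield of \<open>\<rat>(\<zeta>)\<close> other than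
  \<open>\<rat>\<close> contains \<open>\<surd>2\<close>; this is why the single exponent 3 decides everything. The proof carries
  out this argument without fields or representations. They are replaced by traces: a central
  element becomes a matrix in the regular representation, and the character of an eigenspace at
  \<open>g\<close> is the trace of \<open>g\<close> times the spectral projection, a sum of \<open>2\<^sup>m\<close>-th roots of unity.

  The condition on cubes implies the cut-property (\<open>central_unit_trivial\<close>). Let \<open>u\<close> be a central unit,
  \<open>u\<^sup>*\<close> its image under \<open>g \<mapsto> g\<^sup>-\<^sup>1\<close>, and \<open>v = u u\<^sup>*\<close>, whose matrix is symmetric and hence diagonalisable.
  Under the condition every odd power of \<open>g\<close> is conjugate to \<open>g\<close> or \<open>g\<^sup>-\<^sup>1\<close>, so
  \<open>\<chi>(g) + \<chi>(g\<^sup>-\<^sup>1)\<close> can be averaged over the odd powers of \<open>g\<close>, and the average of the odd powers of a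
  root of unity of 2-power order is \<open>0\<close>, \<open>1\<close> or \<open>-1\<close>. So these sums are integers, and if an eigenvalue
  \<open>\<lambda>\<close> of \<open>v\<close> has multiplicity \<open>N\<close>, then \<open>2 N \<lambda>\<^sup>k\<close> is an integer for all \<open>k \<in> \<int>\<close>, whence \<open>|\<lambda>| = 1\<close>.
  The trace of \<open>v\<close> is therefore at most \<open>|G|\<close>; but it is \<open>|G|\<close> times the sum of the squares of the coefficients of
  \<open>u\<close>, so \<open>u\<close> has a single coefficient \<open>\<plusminus>1\<close>.

  The cut-property implies the condition on cubes (\<open>nontrivial_central_unit\<close>). Suppose that \<open>x\<^sup>3\<close> is conjugate neither to
  \<open>x\<close> nor to \<open>x\<^sup>-\<^sup>1\<close>, and weight the odd powers of \<open>x\<close> by the quadratic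
  character \<open>\<theta>\<close> of \<open>\<rat>(\<surd>2)\<close>. Summing over all conjugates and inverses gives a symmetric central element \<open>s\<close>.
  It does not vanish, because no power \<open>x\<^sup>j\<close> with \<open>\<theta>(j) = -1\<close> is conjugate to \<open>x\<close> or \<open>x\<^sup>-\<^sup>1\<close>, and all its
  eigenvalues lie in \<open>\<surd>2 \<rat>\<close>, because \<open>\<theta>\<close>-weighted power sums of roots of unity do. On the eigenspaces
  where \<open>s\<close> is \<open>\<plusminus>\<surd>2 r\<close>, for one rational \<open>r \<noteq> 0\<close>, the polynomials in \<open>s\<close>
  realise \<open>\<rat>(\<surd>2)\<close>, so a unit \<open>A + B \<surd>2\<close> congruent to \<open>1\<close> modulo the denominators
  of the projection lifts to a central unit of the integral group ring with an eigenvalue greater than 1.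

  For the central series, \<open>x\<^sup>3\<close> is congruent to \<open>x\<close> or to \<open>x\<^sup>-\<^sup>1\<close> modulo the next term, since conjugation
  acts trivially on the factor; hence \<open>x\<^sup>2\<close> or \<open>x\<^sup>4\<close> is trivial there. The factors are
  nontrivial because a nontrivial 2-group has a nontrivial centre.
\<close>

(* "order" is to denote the order of a group, not the multiplicity of a root. *)
hide_const (open) Polynomial.order

section \<open>Matrices and traces\<close>

definition hermitian_mat :: "complex mat \<Rightarrow> bool" where
  "hermitian_mat A \<longleftrightarrow> (\<forall>i < dim_row A. \<forall>j < dim_row A. A $$ (j, i) = cnj (A $$ (i, j)))"

definition trace_mat :: "complex mat \<Rightarrow> complex" where
  "trace_mat A = (\<Sum>i < dim_row A. A $$ (i, i))"

definition diagonal :: "nat \<Rightarrow> (nat \<Rightarrow> complex) \<Rightarrow> complex mat" where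
  "diagonal n d = mat n n (\<lambda>(i, j). if i = j then d i else 0)"

lemma diagonal_carrier [simp]: "diagonal n d \<in> carrier_mat n n"
  by (simp add: diagonal_def)

lemma diagonal_one: "diagonal n (\<lambda>_. 1) = 1\<^sub>m n"
  by (intro eq_matI) (auto simp: diagonal_def)

lemma square_mult_closed:
  "A \<in> carrier_mat n n \<Longrightarrow> B \<in> carrier_mat n n \<Longrightarrow> A * B \<in> carrier_mat n n"
  by (rule mult_carrier_mat)

lemma square_assoc:
  fixes A :: "'a::semiring_0 mat"
  shows "A \<in> carrier_mat n n \<Longrightarrow> B \<in> carrier_mat n n \<Longrightarrow> C \<in> carrier_mat n n \<Longrightarrow> A * B * C = A * (B * C)"
  by (rule assoc_mult_mat)

lemma mat_mult_index_sum:
  assumes "A \<in> carrier_mat n n" "B \<in> carrier_mat n n" "i < n" "j < n"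
  shows "(A * B) $$ (i, j) = (\<Sum>k<n. A $$ (i, k) * B $$ (k, j))"
  using assms by (auto simp: scalar_prod_def atLeast0LessThan intro!: sum.cong)

lemma diagonal_times_index:
  assumes "A \<in> carrier_mat n n" "i < n" "j < n"
  shows "(diagonal n d * A) $$ (i, j) = d i * A $$ (i, j)"
proof -
  have "(diagonal n d * A) $$ (i, j) = (\<Sum>k<n. diagonal n d $$ (i, k) * A $$ (k, j))"
    using assms by (intro mat_mult_index_sum) auto
  also have "\<dots> = (\<Sum>k<n. if k = i then d i * A $$ (i, j) else 0)"
    using assms by (intro sum.cong) (auto simp: diagonal_def)
  finally show ?thesis using assms by simp
qed

lemma times_diagonal_index:
  assumes "A \<in> carrier_mat n n" "i < n" "j < n"
  shows "(A * diagonal n d) $$ (i, j) = A $$ (i, j) * d j"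
proof -
  have "(A * diagonal n d) $$ (i, j) = (\<Sum>k<n. A $$ (i, k) * diagonal n d $$ (k, j))"
    using assms by (intro mat_mult_index_sum) auto
  also have "\<dots> = (\<Sum>k<n. if k = j then A $$ (i, j) * d j else 0)"
    using assms by (intro sum.cong) (auto simp: diagonal_def)
  finally show ?thesis using assms by simp
qed

lemma diagonal_mult: "diagonal n c * diagonal n d = diagonal n (\<lambda>i. c i * d i)"
proof (rule eq_matI)
  fix i j assume "i < dim_row (diagonal n (\<lambda>i. c i * d i))" "j < dim_col (diagonal n (\<lambda>i. c i * d i))"
  then have ij: "i < n" "j < n" by (auto simp: diagonal_def)
  show "(diagonal n c * diagonal n d) $$ (i, j) = diagonal n (\<lambda>i. c i * d i) $$ (i, j)"
    by (subst diagonal_times_index) (use ij in \<open>auto simp: diagonal_def\<close>)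
qed (auto simp: diagonal_def)

lemma trace_diagonal: "trace_mat (diagonal n d) = (\<Sum>i<n. d i)"
  by (simp add: trace_mat_def diagonal_def)

lemma trace_mult_commute:
  assumes "A \<in> carrier_mat n n" "B \<in> carrier_mat n n"
  shows "trace_mat (A * B) = trace_mat (B * A)"
proof -
  have "trace_mat (A * B) = (\<Sum>i<n. \<Sum>k<n. A $$ (i, k) * B $$ (k, i))"
    unfolding trace_mat_def using assms by (intro sum.cong) (auto simp: mat_mult_index_sum simp del: index_mult_mat(1))
  also have "\<dots> = (\<Sum>k<n. \<Sum>i<n. A $$ (i, k) * B $$ (k, i))" by (rule sum.swap)
  also have "\<dots> = trace_mat (B * A)"
    unfolding trace_mat_def using assms
    by (intro sum.cong) (auto simp: mat_mult_index_sum mult.commute simp del: index_mult_mat(1))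
  finally show ?thesis .
qed

lemma trace_similar:
  assumes "similar_mat_wit A B P Q" "A \<in> carrier_mat n n"
  shows "trace_mat A = trace_mat B"
proof -
  from similar_mat_witD2[OF assms(2,1)] have
    *: "P * Q = 1\<^sub>m n" "Q * P = 1\<^sub>m n" "A = P * B * Q" "B \<in> carrier_mat n n" "P \<in> carrier_mat n n" "Q \<in> carrier_mat n n"
    by auto
  have "trace_mat A = trace_mat (Q * (P * B))"
    unfolding *(3) by (rule trace_mult_commute) (use *(4-6) in auto)
  also have "Q * (P * B) = (Q * P) * B" by (rule assoc_mult_mat[symmetric]) (use *(4-6) in auto)
  finally show ?thesis using *(2,4) by simp
qed

lemma transpose_pow:
  fixes A :: "complex mat"
  assumes "A \<in> carrier_mat n n" "transpose_mat A = A"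
  shows "transpose_mat (A ^\<^sub>m k) = A ^\<^sub>m k"
proof (induction k)
  case (Suc k)
  have Ak: "A ^\<^sub>m k \<in> carrier_mat n n" using assms(1) by simp
  have comm: "A * A ^\<^sub>m k = A ^\<^sub>m k * A" for k
  proof (induction k)
    case 0
    then show ?case using assms(1) by simp
  next
    case (Suc k)
    have "A ^\<^sub>m k \<in> carrier_mat n n" using assms(1) by simp
    then show ?case using Suc assms(1) by (simp flip: square_assoc[where n = n])
  qed
  have "transpose_mat (A ^\<^sub>m Suc k) = transpose_mat A * transpose_mat (A ^\<^sub>m k)"
    using transpose_mult[OF Ak assms(1)] by simp
  then show ?case using Suc assms(2) comm by simp
qed simp

section \<open>Hermitian matrices are diagonalisable\<close>

lemma hermitian_matD:
  "hermitian_mat A \<Longrightarrow> i < dim_row A \<Longrightarrow> j < dim_row A \<Longrightarrow> A $$ (j, i) = cnj (A $$ (i, j))"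
  unfolding hermitian_mat_def by blast

lemma hermitian_cscalar_prod:
  assumes A: "A \<in> carrier_mat n n" and h: "hermitian_mat A"
    and v: "v \<in> carrier_vec n" and w: "w \<in> carrier_vec n"
  shows "(A *\<^sub>v v) \<bullet>c w = v \<bullet>c (A *\<^sub>v w)"
proof -
  have "(A *\<^sub>v v) \<bullet>c w = (\<Sum>i<n. \<Sum>j<n. A $$ (i, j) * v $ j * cnj (w $ i))"
    using A v w by (auto simp: scalar_prod_def sum_distrib_right atLeast0LessThan intro!: sum.cong)
  also have "\<dots> = (\<Sum>j<n. \<Sum>i<n. A $$ (i, j) * v $ j * cnj (w $ i))" by (rule sum.swap)
  also have "\<dots> = (\<Sum>j<n. \<Sum>i<n. v $ j * cnj (A $$ (j, i) * w $ i))"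
  proof (intro sum.cong refl)
    fix i j assume "j \<in> {..<n}" "i \<in> {..<n}"
    then have "A $$ (i, j) = cnj (A $$ (j, i))" using A by (intro hermitian_matD[OF h]) auto
    then show "A $$ (i, j) * v $ j * cnj (w $ i) = v $ j * cnj (A $$ (j, i) * w $ i)" by simp
  qed
  also have "\<dots> = v \<bullet>c (A *\<^sub>v w)"
    using A v w by (auto simp: scalar_prod_def sum_distrib_left atLeast0LessThan intro!: sum.cong)
  finally show ?thesis .
qed

text \<open>Put \<open>w = (A - l) v\<close>. If \<open>w \<noteq> 0\<close>, then \<open>w\<close> is an eigenvector for \<open>l\<close>, so \<open>l\<close> is real and
  \<open>A - l\<close> is again Hermitian, and \<open>\<langle>w, w\<rangle> = \<langle>v, (A - l) w\<rangle> = 0\<close>.\<close>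

lemma hermitian_kernel_square:
  assumes A: "A \<in> carrier_mat n n" and h: "hermitian_mat A"
    and v: "v \<in> carrier_vec n"
    and z: "(char_matrix A l * char_matrix A l) *\<^sub>v v = 0\<^sub>v n"
  shows "char_matrix A l *\<^sub>v v = 0\<^sub>v n"
proof (rule ccontr)
  define w where "w = char_matrix A l *\<^sub>v v"
  assume "char_matrix A l *\<^sub>v v \<noteq> 0\<^sub>v n"
  then have w0: "w \<noteq> 0\<^sub>v n" by (simp add: w_def)
  have cm: "char_matrix A l \<in> carrier_mat n n" using A by simp
  have w: "w \<in> carrier_vec n" using cm v by (simp add: w_def)
  have cmv: "char_matrix A k *\<^sub>v u = A *\<^sub>v u - k \<cdot>\<^sub>v u" if "u \<in> carrier_vec n" for u k
  proof -
    have "char_matrix A k *\<^sub>v u = A *\<^sub>v u + ((-k) \<cdot>\<^sub>m 1\<^sub>m n) *\<^sub>v u"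
      unfolding char_matrix_def using A that by (subst add_mult_distrib_mat_vec) auto
    also have "((-k) \<cdot>\<^sub>m 1\<^sub>m n) *\<^sub>v u = (-k) \<cdot>\<^sub>v u" using that
      by (intro eq_vecI) (auto simp: scalar_prod_def if_distrib[of "\<lambda>x. _ * x"] if_distrib[of "\<lambda>x. x * _"] cong: if_cong)
    finally show ?thesis using A that by auto
  qed
  have "char_matrix A l *\<^sub>v w = 0\<^sub>v n"
    using z cm v by (simp add: w_def assoc_mult_mat_vec[OF cm cm v])
  then have diff: "A *\<^sub>v w - l \<cdot>\<^sub>v w = 0\<^sub>v n" using cmv[OF w, of l] by simp
  have Aw: "A *\<^sub>v w = l \<cdot>\<^sub>v w"
  proof (rule eq_vecI)
    fix i assume "i < dim_vec (l \<cdot>\<^sub>v w)"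
    then show "(A *\<^sub>v w) $ i = (l \<cdot>\<^sub>v w) $ i"
      using arg_cong[OF diff, of "\<lambda>x. x $ i"] A w by (auto simp del: index_mult_mat_vec)
  qed (use A w in auto)
  have pos: "w \<bullet>c w \<noteq> 0" using w w0 by simp
  have "l * (w \<bullet>c w) = (A *\<^sub>v w) \<bullet>c w" using Aw w by simp
  also have "\<dots> = w \<bullet>c (A *\<^sub>v w)" by (rule hermitian_cscalar_prod[OF A h w w])
  also have "\<dots> = cnj l * (w \<bullet>c w)" using Aw w by (simp add: conjugate_smult_vec)
  finally have real: "cnj l = l" using pos by simp
  have "w \<bullet>c w = (A *\<^sub>v v) \<bullet>c w - (l \<cdot>\<^sub>v v) \<bullet>c w"
    using cmv[OF v, of l] A v w unfolding w_def by (simp add: minus_scalar_prod_distrib[of _ n])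
  also have "(A *\<^sub>v v) \<bullet>c w = v \<bullet>c (l \<cdot>\<^sub>v w)" using hermitian_cscalar_prod[OF A h v w] Aw by simp
  also have "\<dots> = l * (v \<bullet>c w)" using v w by (simp add: conjugate_smult_vec real)
  also have "(l \<cdot>\<^sub>v v) \<bullet>c w = l * (v \<bullet>c w)" using v w by simp
  finally show False using pos by simp
qed

lemma jordan_matrix_diagonal:
  assumes "\<And>m l. (m, l) \<in> set as \<Longrightarrow> m = 1" "i < length as" "j < length as" "i \<noteq> j"
  shows "jordan_matrix as $$ (i, j) = 0"
  using assms
proof (induction as arbitrary: i j)
  case (Cons a as)
  obtain l where a: "a = (1, l)" using Cons.prems(1)[of "fst a" "snd a"] by (cases a) auto
  have ones: "map fst as = replicate (length as) 1"
    using Cons.prems(1) by (intro replicate_eqI) force+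
  have dim: "sum_list (map fst as) = length as" unfolding ones by (simp add: sum_list_replicate)
  have J: "jordan_matrix (a # as) = four_block_mat (jordan_block 1 l) (0\<^sub>m 1 (length as)) (0\<^sub>m (length as) 1) (jordan_matrix as)"
    using jordan_matrix_dim[of as] unfolding jordan_matrix_def a by (simp add: Let_def dim)
  have IH: "jordan_matrix as $$ (i', j') = 0" if "i' < length as" "j' < length as" "i' \<noteq> j'" for i' j'
    by (rule Cons.IH) (use Cons.prems(1) that in auto)
  have dims: "dim_row (jordan_matrix as) = length as" "dim_col (jordan_matrix as) = length as"
    by (simp_all add: dim)
  show ?case
    using Cons.prems(2-4) IH[of "i - 1" "j - 1"] unfolding J
    by (cases i; cases j) (simp_all add: dims dim)
qed simp

lemma kernel_dim_cong:
  assumes "mat_kernel A = mat_kernel B" "dim_col A = dim_col B"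
  shows "kernel_dim A = kernel_dim B"
  unfolding kernel_dim_def assms by simp

text \<open>A Jordan block of size at least 2 for \<open>l\<close> would make the kernel of \<open>(A - l)\<^sup>2\<close> larger than that of
  \<open>A - l\<close>. As these kernels agree, the Jordan form is diagonal.\<close>

lemma hermitian_diagonalisable:
  assumes A: "A \<in> carrier_mat n n" and h: "hermitian_mat A"
  shows "\<exists>P Q d. similar_mat_wit A (diagonal n d) P Q"
proof -
  obtain es where "char_poly A = (\<Prod>a\<leftarrow>es. [:- a, 1:])" using char_poly_factorized[OF A] by blast
  from jordan_nf_exists[OF A this] obtain as where jnf: "jordan_nf A as" by blast
  have one: "m = 1" if mem: "(m, l) \<in> set as" for m l
  proof -
    let ?C = "char_matrix A l"
    have C: "?C \<in> carrier_mat n n" using A by simp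
    have p1: "?C ^\<^sub>m 1 = ?C" using C by simp
    have p2: "?C ^\<^sub>m 2 = ?C * ?C" using C by (simp add: numeral_2_eq_2)
    have "mat_kernel (?C * ?C) = mat_kernel ?C"
    proof (intro equalityI subsetI)
      fix v assume "v \<in> mat_kernel (?C * ?C)"
      then show "v \<in> mat_kernel ?C"
        using hermitian_kernel_square[OF A h, of v l] C by (auto simp: mat_kernel_def)
    next
      fix v assume "v \<in> mat_kernel ?C"
      then show "v \<in> mat_kernel (?C * ?C)"
        using C by (auto simp: mat_kernel_def assoc_mult_mat_vec[OF C C])
    qed
    then have "kernel_dim (?C ^\<^sub>m 2) = kernel_dim (?C ^\<^sub>m 1)"
      unfolding p1 p2 using C by (intro kernel_dim_cong) auto
    then have "dim_gen_eigenspace A l 2 = dim_gen_eigenspace A l 1"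
      unfolding dim_gen_eigenspace_def .
    then have eq: "(\<Sum>n\<leftarrow>map fst [(n, e)\<leftarrow>as . e = l]. min 2 n) = (\<Sum>n\<leftarrow>map fst [(n, e)\<leftarrow>as . e = l]. min 1 n)"
      unfolding dim_gen_eigenspace[OF jnf] .
    define bs where "bs = map fst [(n, e)\<leftarrow>as . e = l]"
    have mb: "m \<in> set bs" using mem unfolding bs_def by force
    have "m \<le> 1"
    proof (rule ccontr)
      assume "\<not> m \<le> 1"
      then have "(\<Sum>n\<leftarrow>bs. min 1 n) < (\<Sum>n\<leftarrow>bs. min 2 n)"
        using mb
      proof (induction bs)
        case (Cons b bs)
        have le: "(\<Sum>n\<leftarrow>bs. min 1 n) \<le> (\<Sum>n\<leftarrow>bs. min 2 n)" by (intro sum_list_mono) simp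
        show ?case using Cons le by (cases "m = b") (auto simp: min_def)
      qed simp
      then show False using eq unfolding bs_def by simp
    qed
    moreover have "m \<noteq> 0" using jnf mem unfolding jordan_nf_def by force
    ultimately show ?thesis by simp
  qed
  obtain P Q where sim: "similar_mat_wit A (jordan_matrix as) P Q"
    using jnf unfolding jordan_nf_def similar_mat_def by blast
  have J: "jordan_matrix as \<in> carrier_mat n n" using similar_mat_witD2[OF A sim] by simp
  have "map fst as = replicate (length as) 1" using one by (intro replicate_eqI) force+
  then have "sum_list (map fst as) = length as" by (simp add: sum_list_replicate)
  then have len: "length as = n" using carrier_matD(1)[OF J] by simp
  have "jordan_matrix as = diagonal n (\<lambda>i. jordan_matrix as $$ (i, i))"
    using J jordan_matrix_diagonal[of as, OF one] len
    by (intro eq_matI) (auto simp: diagonal_def)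
  then show ?thesis using sim by metis
qed

lemma upper_triangular_mult:
  fixes A B :: "complex mat"
  assumes A: "A \<in> carrier_mat n n" "upper_triangular A" and B: "B \<in> carrier_mat n n" "upper_triangular B"
  shows "upper_triangular (A * B)" and "i < n \<Longrightarrow> (A * B) $$ (i, i) = A $$ (i, i) * B $$ (i, i)"
proof -
  have entry: "(A * B) $$ (i, j) = (\<Sum>k<n. A $$ (i, k) * B $$ (k, j))" if "i < n" "j < n" for i j
    using A(1) B(1) that by (rule mat_mult_index_sum)
  show "upper_triangular (A * B)"
  proof (rule upper_triangularI)
    fix i j assume ji: "j < i" "i < dim_row (A * B)"
    then have i: "i < n" using A by simp
    have "A $$ (i, k) * B $$ (k, j) = 0" if "k < n" for k
    proof (cases "k < i")
      case True
      then show ?thesis using upper_triangularD[OF A(2) True] A(1) i by simp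
    next
      case False
      then have "j < k" using ji by simp
      then show ?thesis using upper_triangularD[OF B(2), of j k] B(1) that by simp
    qed
    then show "(A * B) $$ (i, j) = 0"
      unfolding entry[OF i order.strict_trans[OF ji(1) i]] by (intro sum.neutral) auto
  qed
  assume i: "i < n"
  have "A $$ (i, k) * B $$ (k, i) = (if k = i then A $$ (i, i) * B $$ (i, i) else 0)" if "k < n" for k
  proof (cases k i rule: linorder_cases)
    case less
    then have "A $$ (i, k) = 0" using upper_triangularD[OF A(2) less] A(1) i by simp
    then show ?thesis using less by simp
  next
    case greater
    then have "B $$ (k, i) = 0" using upper_triangularD[OF B(2) greater] B(1) that by simp
    then show ?thesis using greater by simp
  qed simp
  then have "(\<Sum>k<n. A $$ (i, k) * B $$ (k, i)) = (\<Sum>k<n. if k = i then A $$ (i, i) * B $$ (i, i) else 0)"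
    by (intro sum.cong) blast+
  then show "(A * B) $$ (i, i) = A $$ (i, i) * B $$ (i, i)" unfolding entry[OF i i] using i by simp
qed

lemma upper_triangular_pow:
  fixes B :: "complex mat"
  assumes B: "B \<in> carrier_mat n n" "upper_triangular B"
  shows "upper_triangular (B ^\<^sub>m k) \<and> (\<forall>i<n. (B ^\<^sub>m k) $$ (i, i) = (B $$ (i, i)) ^ k)"
proof (induction k)
  case 0
  then show ?case using B(1) by auto
next
  case (Suc k)
  have Bk: "B ^\<^sub>m k \<in> carrier_mat n n" using B(1) by simp
  show ?case using upper_triangular_mult[OF Bk _ B] Suc by simp
qed

text \<open>The numbers \<open>b i\<close> are the diagonal entries of a Schur triangular form, that is, the eigenvalues with
  multiplicity. The second property transfers polynomial identities between powers of the matrix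
  to its eigenvalues.\<close>

lemma trace_powers:
  assumes A: "A \<in> carrier_mat n n"
  obtains b where "\<And>k. trace_mat (A ^\<^sub>m k) = (\<Sum>i<n. b i ^ k)"
    and "\<And>k l i. A ^\<^sub>m k = A ^\<^sub>m l \<Longrightarrow> i < n \<Longrightarrow> b i ^ k = b i ^ l"
proof -
  obtain es where "char_poly A = (\<Prod>a\<leftarrow>es. [:- a, 1:])" using char_poly_factorized[OF A] by blast
  from schur_decomposition_exists[OF A this] obtain B where
    B: "B \<in> carrier_mat n n" "upper_triangular B" and "similar_mat A B" by blast
  then obtain P Q where sim: "similar_mat_wit A B P Q" unfolding similar_mat_def by blast
  have pow: "similar_mat_wit (A ^\<^sub>m k) (B ^\<^sub>m k) P Q" for k
    using similar_mat_wit_pow[OF sim] .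
  have 1: "trace_mat (A ^\<^sub>m k) = (\<Sum>i<n. B $$ (i, i) ^ k)" for k
  proof -
    have "trace_mat (A ^\<^sub>m k) = trace_mat (B ^\<^sub>m k)"
      by (rule trace_similar[OF pow, where n = n]) (use A in simp)
    then show ?thesis using upper_triangular_pow[OF B, of k] B(1) by (simp add: trace_mat_def)
  qed
  have 2: "B $$ (i, i) ^ k = B $$ (i, i) ^ l" if "A ^\<^sub>m k = A ^\<^sub>m l" "i < n" for k l i
  proof -
    have "B ^\<^sub>m m = Q * A ^\<^sub>m m * P" for m
      using similar_mat_wit_sym[OF pow[of m]] unfolding similar_mat_wit_def Let_def by blast
    then have "B ^\<^sub>m k = B ^\<^sub>m l" using that(1) by simp
    then show ?thesis
      using upper_triangular_pow[OF B, of k] upper_triangular_pow[OF B, of l] that(2) by metis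
  qed
  show thesis using that[of "\<lambda>i. B $$ (i, i)"] 1 2 by blast
qed

section \<open>Power sums of roots of unity of 2-power order\<close>

text \<open>The quadratic Dirichlet character modulo 8 that belongs to the field \<open>\<rat>(\<surd>2)\<close>.\<close>

definition theta :: "nat \<Rightarrow> complex" where
  "theta j = (if j mod 8 \<in> {1, 7} then 1 else if j mod 8 \<in> {3, 5} then -1 else 0)"

lemma theta_cases: "theta j = 0 \<or> theta j = 1 \<or> theta j = -1"
  by (simp add: theta_def)

lemma sum_lessThan_add:
  fixes f :: "nat \<Rightarrow> 'a::comm_monoid_add"
  shows "(\<Sum>j<a + c. f j) = (\<Sum>j<a. f j) + (\<Sum>r<c. f (a + r))"
  by (induction c) (simp_all add: add.assoc)

lemma sum_blocks:
  fixes f :: "nat \<Rightarrow> 'a::comm_monoid_add"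
  shows "(\<Sum>j<c*q. f j) = (\<Sum>k<q. \<Sum>r<c. f (c * k + r))"
proof (induction q)
  case (Suc q)
  have "(\<Sum>j<c * Suc q. f j) = (\<Sum>j<c*q + c. f j)" by (simp add: add.commute)
  then show ?case using Suc by (simp add: sum_lessThan_add)
qed simp

lemma geometric_sum_root_of_unity:
  fixes x :: complex
  assumes "x ^ q = 1" "x \<noteq> 1"
  shows "(\<Sum>k<q. x ^ k) = 0"
  using assms by (simp add: geometric_sum)

text \<open>The sum is \<open>b\<close> times a geometric series in \<open>b\<^sup>2\<close> of length \<open>2\<^bsup>m-1\<^esup>\<close>, which vanishes unless
  \<open>b = \<plusminus>1\<close>. The case \<open>b = 0\<close> is there because traces against a projection contribute zero eigenvalues.\<close>

lemma sum_odd_powers_root_of_unity: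
  fixes b :: complex
  assumes b: "b = 0 \<or> b ^ 2 ^ m = 1" and m: "m \<ge> 1"
  shows "\<exists>z::int. (\<Sum>j<2 ^ m. if odd j then b ^ j else 0) = of_int (2 ^ (m - 1) * z)"
proof -
  define q :: nat where "q = 2 ^ (m - 1)"
  have q: "2 ^ m = 2 * q" using m by (cases m) (simp_all add: q_def)
  have "(\<Sum>j<2 ^ m. if odd j then b ^ j else 0) = (\<Sum>k<q. \<Sum>r<2. if odd (2 * k + r) then b ^ (2 * k + r) else 0)"
    unfolding q by (rule sum_blocks)
  also have "\<dots> = (\<Sum>k<q. b * (b\<^sup>2) ^ k)"
  proof (intro sum.cong refl)
    fix k
    have "(\<Sum>r<2. F r) = F 0 + F 1" for F :: "nat \<Rightarrow> complex"
      by (simp add: lessThan_nat_numeral lessThan_Suc)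
    then show "(\<Sum>r<2. if odd (2 * k + r) then b ^ (2 * k + r) else 0) = b * (b\<^sup>2) ^ k"
      by (simp add: power_mult)
  qed
  also have "\<dots> = b * (\<Sum>k<q. (b\<^sup>2) ^ k)" by (simp add: sum_distrib_left)
  finally have eq: "(\<Sum>j<2 ^ m. if odd j then b ^ j else 0) = b * (\<Sum>k<q. (b\<^sup>2) ^ k)" .
  consider "b = 0" | "b = 1" | "b = -1" | "b\<^sup>2 \<noteq> 1" "b ^ (2 * q) = 1"
    using b by (auto simp: q power2_eq_1_iff)
  then show ?thesis
  proof cases
    case 4
    then have "(\<Sum>k<q. (b\<^sup>2) ^ k) = 0" by (intro geometric_sum_root_of_unity) (auto simp: power_mult)
    then show ?thesis unfolding eq by (intro exI[of _ 0]) simp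
  qed (unfold eq, auto simp: q_def intro: exI[of _ 0] exI[of _ 1] exI[of _ "-1"])
qed

text \<open>A multiple of the Gauss sum of \<open>theta\<close>: grouping by residues modulo 8 gives a geometric series
  in \<open>b\<^sup>8\<close>, so only \<open>b\<^sup>8 = 1\<close> matters, and the Gauss sum \<open>b - b\<^sup>3 - b\<^sup>5 + b\<^sup>7\<close> has square 8 for primitive eighth roots
  of unity and is 0 for the others.\<close>

lemma sum_theta_powers_root_of_unity:
  fixes b :: complex
  assumes b: "b = 0 \<or> b ^ 2 ^ m = 1" and m: "m \<ge> 3"
  shows "\<exists>z::int. (\<Sum>j<2 ^ m. theta j * b ^ j) = of_int z * of_real (sqrt 2)"
proof -
  define q :: nat where "q = 2 ^ (m - 3)"
  have q: "2 ^ m = 8 * q" using m power_add[of "2::nat" 3 "m - 3"] by (simp add: q_def)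
  define D where "D = b - b ^ 3 - b ^ 5 + b ^ 7"
  have th: "theta (8 * k + r) = theta r" for k r by (simp add: theta_def)
  have "(\<Sum>r<8. theta (8 * k + r) * b ^ (8 * k + r)) = (b ^ 8) ^ k * D" for k
  proof -
    have "(\<Sum>r<8. theta r * x r) = x 1 - x 3 - x 5 + x 7" for x :: "nat \<Rightarrow> complex"
      by (simp add: lessThan_nat_numeral lessThan_Suc theta_def)
    moreover have "b ^ (8 * k + r) = (b ^ 8) ^ k * b ^ r" for r by (simp only: power_add power_mult)
    ultimately show ?thesis unfolding th D_def by (simp only: power_one_right right_diff_distrib distrib_left)
  qed
  then have eq: "(\<Sum>j<2 ^ m. theta j * b ^ j) = (\<Sum>k<q. (b ^ 8) ^ k) * D"
    unfolding q sum_blocks by (simp add: sum_distrib_right)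
  show ?thesis
  proof (cases "b ^ 8 = 1")
    case False
    then have "(\<Sum>k<q. (b ^ 8) ^ k) * D = 0"
      using b geometric_sum_root_of_unity[of "b ^ 8" q] by (auto simp: q D_def power_mult)
    then show ?thesis unfolding eq by (intro exI[of _ 0]) simp
  next
    case True
    then have "(b ^ 4)\<^sup>2 = 1" by (simp flip: power_mult)
    then have "b ^ 4 = 1 \<or> b ^ 4 = -1" unfolding power2_eq_1_iff .
    then have "D = 0 \<or> D = of_real (2 * sqrt 2) \<or> D = - of_real (2 * sqrt 2)"
    proof
      assume b4: "b ^ 4 = 1"
      have "b ^ 5 = b" "b ^ 7 = b ^ 3" using b4 power_add[of b 4 1] power_add[of b 4 3] by simp_all
      then show ?thesis by (simp add: D_def)
    next
      assume b4: "b ^ 4 = -1"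
      have b5: "b ^ 5 = - b" "b ^ 7 = - (b ^ 3)" "b ^ 6 = - (b\<^sup>2)"
        using b4 power_add[of b 4 1] power_add[of b 4 3] power_add[of b 4 2] by simp_all
      have "D = 2 * (b - b ^ 3)" by (simp add: D_def b5)
      then have "D\<^sup>2 = 4 * (b\<^sup>2 - 2 * (b * b ^ 3) + (b ^ 3)\<^sup>2)"
        by (simp only:) (simp add: power2_eq_square algebra_simps)
      also have "b * b ^ 3 = b ^ 4" by (simp flip: power_Suc)
      also have "(b ^ 3)\<^sup>2 = b ^ 6" by (simp flip: power_mult)
      also have "4 * (b\<^sup>2 - 2 * b ^ 4 + b ^ 6) = 8" by (simp add: b4 b5)
      also have "\<dots> = (of_real (2 * sqrt 2))\<^sup>2"
        unfolding of_real_power[symmetric] by (simp add: power_mult_distrib)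
      finally show ?thesis unfolding power2_eq_iff by blast
    qed
    then show ?thesis unfolding eq True
      by (elim disjE) (auto intro: exI[of _ 0] exI[of _ "2 * int q"] exI[of _ "- 2 * int q"])
  qed
qed

section \<open>Powers of 3 modulo powers of 2, Pell equations, integrality\<close>

text \<open>The exact power of 2 dividing \<open>j\<^bsup>2^(m+1)\<^esup> - 1\<close>: squaring \<open>1 + 2\<^sup>k w\<close> with \<open>w\<close> odd raises \<open>k\<close> by exactly one.\<close>

lemma power_two_power_eq:
  fixes j :: int
  assumes "j mod 8 = 3 \<or> j mod 8 = 5"
  shows "\<exists>w. odd w \<and> j ^ 2 ^ (m + 1) = 1 + 2 ^ (m + 3) * w"
proof (induction m)
  case 0
  have "\<exists>c. j = 8 * c + 3 \<or> j = 8 * c + 5" using assms by presburger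
  then obtain c where "j = 8 * c + 3 \<or> j = 8 * c + 5" by blast
  then have "j ^ 2 = 1 + 8 * (8 * c\<^sup>2 + 6 * c + 1) \<or> j ^ 2 = 1 + 8 * (8 * c\<^sup>2 + 10 * c + 3)"
    by (auto simp: power2_eq_square algebra_simps)
  moreover have "odd (8 * c\<^sup>2 + 6 * c + 1)" "odd (8 * c\<^sup>2 + 10 * c + 3)" by simp_all
  ultimately obtain w where "odd w" "j ^ 2 = 1 + 8 * w" by metis
  then show ?case by (intro exI[of _ w]) simp
next
  case (Suc m)
  then obtain w where w: "odd w" "j ^ 2 ^ (m + 1) = 1 + 2 ^ (m + 3) * w" by blast
  have "j ^ 2 ^ (Suc m + 1) = (j ^ 2 ^ (m + 1))\<^sup>2" by (simp flip: power_mult add: mult.commute)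
  also have "\<dots> = 1 + 2 ^ (Suc m + 3) * (w + 2 ^ (m + 2) * w\<^sup>2)"
    unfolding w(2) by (simp add: power2_eq_square power_add algebra_simps)
  finally show ?case using w(1) by (intro exI[of _ "w + 2 ^ (m + 2) * w\<^sup>2"]) simp
qed

text \<open>The odd residues modulo \<open>2\<^sup>m\<close> are generated by \<open>-1\<close> and any \<open>j \<equiv> \<plusminus>3\<close> modulo 8. A congruence
  modulo \<open>2\<^sup>m\<close> that fails modulo \<open>2\<^bsup>m+1\<^esup>\<close> is off by \<open>2\<^sup>m\<close>, which a further factor \<open>j\<^bsup>2^(m-2)\<^esup>\<close> corrects.\<close>

lemma odd_eq_pm_power:
  fixes a j :: int
  assumes j: "j mod 8 = 3 \<or> j mod 8 = 5" and a: "odd a"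
  shows "\<exists>k. 2 ^ m dvd a - j ^ k \<or> 2 ^ m dvd a + j ^ k"
proof -
  have "\<exists>k. 2 ^ (m + 3) dvd a - j ^ k \<or> 2 ^ (m + 3) dvd a + j ^ k" for m
  proof (induction m)
    case 0
    have "8 dvd a - 1 \<or> 8 dvd a + 1 \<or> 8 dvd a - j \<or> 8 dvd a + j" using j a by presburger
    then show ?case by (auto intro: exI[of _ 0] exI[of _ 1])
  next
    case (Suc m)
    from power_two_power_eq[OF j, of m] obtain w
      where w: "odd w" "j ^ 2 ^ (m + 1) = 1 + 2 ^ (m + 3) * w" by blast
    have oj: "odd (j ^ k)" for k using j by (auto; presburger)
    let ?k' = "\<lambda>k. k + 2 ^ (m + 1)"
    have kk: "j ^ ?k' k = j ^ k + 2 ^ (m + 3) * (j ^ k * w)" for k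
      by (simp only: power_add[of j k] w(2)) (simp add: algebra_simps)
    have half: "2 ^ (Suc m + 3) dvd 2 ^ (m + 3) * (t::int)" if "even t" for t
      using that by (auto elim!: evenE simp: power_add mult_dvd_mono)
    from Suc obtain k where "2 ^ (m + 3) dvd a - j ^ k \<or> 2 ^ (m + 3) dvd a + j ^ k" by blast
    then show ?case
    proof
      assume "2 ^ (m + 3) dvd a - j ^ k"
      then obtain t where t: "a - j ^ k = 2 ^ (m + 3) * t" by (elim dvdE)
      show ?thesis
      proof (cases "even t")
        case True then show ?thesis using half t by metis
      next
        case False
        have "a - j ^ ?k' k = 2 ^ (m + 3) * (t - j ^ k * w)" using t unfolding kk by (simp add: algebra_simps)
        moreover have "even (t - j ^ k * w)" using False oj w(1) by simp
        ultimately show ?thesis using half by metis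
      qed
    next
      assume "2 ^ (m + 3) dvd a + j ^ k"
      then obtain t where t: "a + j ^ k = 2 ^ (m + 3) * t" by (elim dvdE)
      show ?thesis
      proof (cases "even t")
        case True then show ?thesis using half t by metis
      next
        case False
        have "a + j ^ ?k' k = 2 ^ (m + 3) * (t + j ^ k * w)" using t unfolding kk by (simp add: algebra_simps)
        moreover have "even (t + j ^ k * w)" using False oj w(1) by simp
        ultimately show ?thesis using half by metis
      qed
    qed
  qed
  from this[of m] show ?thesis by (meson dvd_trans le_add1 le_imp_power_dvd)
qed

text \<open>The coordinates of the powers of \<open>3 + 2\<surd>2\<close>.\<close>

fun pell :: "nat \<Rightarrow> int \<times> int" where
  "pell 0 = (1, 0)"
| "pell (Suc k) = (3 * fst (pell k) + 4 * snd (pell k), 2 * fst (pell k) + 3 * snd (pell k))"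

text \<open>Two powers of \<open>3 + 2\<surd>2\<close> with congruent coordinates exist by the pigeonhole principle; the norm-one quotient of
  the two has its \<open>\<surd>2\<close>-coordinate divisible by \<open>N\<close>.\<close>

lemma pell_solution_divisible:
  fixes N :: int
  assumes N: "N > 0"
  shows "\<exists>x y. x\<^sup>2 - 2 * y\<^sup>2 = 1 \<and> N dvd y \<and> y > 0"
proof -
  define x y where "x k = fst (pell k)" and "y k = snd (pell k)" for k
  have eq: "(x k)\<^sup>2 - 2 * (y k)\<^sup>2 = 1" for k
    by (induction k) (simp_all add: x_def y_def power2_eq_square algebra_simps)
  have pos: "x k > 0 \<and> y k \<ge> 0" for k by (induction k) (simp_all add: x_def y_def)
  have "y k < y (Suc k)" for k using pos[of k] by (simp add: x_def y_def)
  then have mono: "strict_mono y" by (rule strict_mono_Suc_iff[THEN iffD2, rule_format])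
  have "\<not> inj (\<lambda>k. (x k mod N, y k mod N))"
  proof
    assume "inj (\<lambda>k. (x k mod N, y k mod N))"
    moreover have "finite (range (\<lambda>k. (x k mod N, y k mod N)))"
      by (rule finite_subset[of _ "{0..N} \<times> {0..N}"]) (use N in \<open>auto simp: less_imp_le\<close>)
    ultimately show False using finite_imageD infinite_UNIV_nat by blast
  qed
  then obtain i j where ij: "i \<noteq> j" "x i mod N = x j mod N" "y i mod N = y j mod N"
    unfolding inj_def by auto
  (* the product of one power with the conjugate of the other *)
  define z w where "z = x i * x j - 2 * y i * y j" and "w = x i * y j - x j * y i"
  have "z\<^sup>2 - 2 * w\<^sup>2 = ((x i)\<^sup>2 - 2 * (y i)\<^sup>2) * ((x j)\<^sup>2 - 2 * (y j)\<^sup>2)"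
    unfolding z_def w_def by (simp add: power2_eq_square algebra_simps)
  then have zw: "z\<^sup>2 - 2 * w\<^sup>2 = 1" by (simp add: eq)
  have "w mod N = (x i * y i - x i * y i) mod N"
    unfolding w_def using ij(2,3) by (metis mod_diff_cong mod_mult_cong)
  then have "N dvd w" by (simp add: mod_0_imp_dvd)
  moreover have "w \<noteq> 0"
  proof
    assume "w = 0"
    then have "x i * y j = x j * y i" by (simp add: w_def)
    then have "(x i)\<^sup>2 * (y j)\<^sup>2 = (x j)\<^sup>2 * (y i)\<^sup>2" by (metis power_mult_distrib)
    moreover have "(x k)\<^sup>2 = 1 + 2 * (y k)\<^sup>2" for k using eq[of k] by simp
    ultimately have "(y j)\<^sup>2 = (y i)\<^sup>2" by (simp add: algebra_simps)
    then have "y j = y i" using pos by (simp add: power2_eq_iff_nonneg)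
    then show False using ij(1) mono strict_mono_eq by metis
  qed
  ultimately show ?thesis using zw by (intro exI[of _ z] exI[of _ "\<bar>w\<bar>"]) simp
qed

lemma single_support_of_square_sum_le_one:
  fixes k :: "'a \<Rightarrow> int"
  assumes "finite C" "(\<Sum>g\<in>C. (k g)\<^sup>2) \<le> 1" "g0 \<in> C" "k g0 \<noteq> 0"
  shows "k g0 = 1 \<or> k g0 = -1" and "\<And>g. g \<in> C \<Longrightarrow> g \<noteq> g0 \<Longrightarrow> k g = 0"
proof -
  have ge: "1 \<le> (k g)\<^sup>2" if "k g \<noteq> 0" for g using that by (simp add: int_one_le_iff_zero_less)
  have eq: "(\<Sum>g\<in>C. (k g)\<^sup>2) = (k g0)\<^sup>2 + (\<Sum>g\<in>C - {g0}. (k g)\<^sup>2)"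
    using assms by (simp add: sum.remove)
  have nn: "0 \<le> (\<Sum>g\<in>C - {g0}. (k g)\<^sup>2)" by (intro sum_nonneg) simp
  have "(k g0)\<^sup>2 = 1" using ge[OF assms(4)] eq nn assms(2) by linarith
  then show "k g0 = 1 \<or> k g0 = -1" by (simp add: power2_eq_1_iff)
  have "(\<Sum>g\<in>C - {g0}. (k g)\<^sup>2) = 0" using ge[OF assms(4)] eq nn assms(2) by linarith
  then show "k g = 0" if "g \<in> C" "g \<noteq> g0" for g
    using that assms(1) by (subst (asm) sum_nonneg_eq_0_iff) auto
qed

lemma common_denominator:
  assumes "finite C" "\<And>g. g \<in> C \<Longrightarrow> c g \<in> (\<rat> :: complex set)"
  shows "\<exists>N::int. N > 0 \<and> (\<forall>g\<in>C. of_int N * c g \<in> \<int>)"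
  using assms
proof (induction C)
  case empty
  show ?case by (intro exI[of _ 1]) simp
next
  case (insert x C)
  then obtain N where N: "N > 0" "\<And>g. g \<in> C \<Longrightarrow> of_int N * c g \<in> \<int>" by blast
  obtain a b :: int where b: "b > 0" "c x = of_int a / of_int b" using insert.prems[of x] by (auto elim: Rats_cases')
  show ?case
  proof (intro exI[of _ "b * N"] conjI ballI)
    show "b * N > 0" using b N by simp
    fix g assume "g \<in> insert x C"
    then consider "g = x" | "g \<in> C" by blast
    then show "of_int (b * N) * c g \<in> \<int>"
    proof cases
      case 1
      have "of_int (b * N) * c g = of_int (N * a)" using b 1 by simp
      then show ?thesis by (simp only: Ints_of_int)
    next
      case 2
      have "of_int (b * N) * c g = of_int b * (of_int N * c g)" by simp
      then show ?thesis using N(2)[OF 2] by (simp only: Ints_mult Ints_of_int)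
    qed
  qed
qed

text \<open>If \<open>|l| < 1\<close>, the nonzero integers \<open>c l\<^sup>k\<close> would tend to 0. The same holds for the inverse of \<open>l\<close>. This stands in for the
  fact that an eigenvalue of a unit which happens to be rational is \<open>\<plusminus>1\<close>.\<close>

lemma norm_one_of_integral_multiples:
  fixes l :: complex and c :: complex
  assumes c: "c \<noteq> 0" and l: "l \<noteq> 0" and p: "\<And>k. c * l ^ k \<in> \<int>" and n: "\<And>k. c * (inverse l) ^ k \<in> \<int>"
  shows "norm l = 1"
proof -
  have ge: "1 \<le> norm l" if l: "l \<noteq> 0" and p: "\<And>k. c * l ^ k \<in> \<int>" for l :: complex
  proof (rule ccontr)
    assume "\<not> 1 \<le> norm l"
    then obtain k where k: "norm l ^ k < 1 / norm c"
      using real_arch_pow_inv[of "1 / norm c" "norm l"] c by auto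
    obtain z where z: "c * l ^ k = of_int z" using p[of k] by (auto elim: Ints_cases)
    have "norm (c * l ^ k) < 1" using k c by (simp add: norm_mult norm_power field_simps)
    then have "z = 0" unfolding z by simp
    then show False using z c l by simp
  qed
  have "1 \<le> inverse (norm l)" using ge[of "inverse l", OF _ n] l by (simp add: norm_inverse)
  then have "norm l \<le> 1" by (simp add: one_le_inverse_iff)
  with ge[OF l p] show ?thesis by simp
qed

section \<open>Functions of a diagonalised matrix\<close>

text \<open>For a matrix \<open>P diag(d) Q\<close> with \<open>Q\<close> inverse to \<open>P\<close>, the polynomial functional calculus: applying \<open>F\<close> to the matrix is
  the case \<open>f = F \<circ> d\<close>.\<close>

definition spectral :: "complex mat \<Rightarrow> complex mat \<Rightarrow> nat \<Rightarrow> (nat \<Rightarrow> complex) \<Rightarrow> complex mat" where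
  "spectral P Q n f = P * diagonal n f * Q"

locale eigenbasis =
  fixes P Q :: "complex mat" and n :: nat
  assumes P: "P \<in> carrier_mat n n" and Q: "Q \<in> carrier_mat n n"
    and PQ: "P * Q = 1\<^sub>m n" and QP: "Q * P = 1\<^sub>m n"
begin

lemmas mult_closed [simp] = square_mult_closed[where n = n]
lemmas one_mult [simp] = left_mult_one_mat[of _ n n] right_mult_one_mat[of _ n n]
lemmas assoc = square_assoc[where n = n]

lemma spectral_carrier [simp]: "spectral P Q n f \<in> carrier_mat n n"
  unfolding spectral_def using P Q by (intro mult_carrier_mat[of _ n n]) auto

lemma conjugate_mult:
  assumes W: "W \<in> carrier_mat n n" and Y: "Y \<in> carrier_mat n n"
  shows "(P * W * Q) * (P * Y * Q) = P * (W * Y) * Q"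
proof -
  have "(P * W * Q) * (P * Y * Q) = (P * W) * (Q * (P * (Y * Q)))"
    using P Q W Y by (simp add: assoc)
  also have "Q * (P * (Y * Q)) = (Q * P) * (Y * Q)"
    using P Q Y by (simp add: assoc)
  also have "\<dots> = Y * Q" using Q Y unfolding QP by (intro left_mult_one_mat[of _ n n] mult_carrier_mat[of _ n n])
  also have "(P * W) * (Y * Q) = P * (W * Y) * Q"
    using P Q W Y by (simp add: assoc)
  finally show ?thesis .
qed

lemma spectral_mult: "spectral P Q n f * spectral P Q n g = spectral P Q n (\<lambda>i. f i * g i)"
  unfolding spectral_def by (simp add: conjugate_mult diagonal_mult)

lemma spectral_one: "spectral P Q n (\<lambda>_. 1) = 1\<^sub>m n"
  unfolding spectral_def diagonal_one using P PQ by simp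

lemma spectral_pow: "spectral P Q n f ^\<^sub>m k = spectral P Q n (\<lambda>i. f i ^ k)"
proof (induction k)
  case 0
  then show ?case using carrier_matD(1)[OF spectral_carrier[of f]] by (simp add: spectral_one)
next
  case (Suc k)
  then show ?case by (simp add: spectral_mult mult.commute)
qed

lemma spectral_linear:
  "spectral P Q n (\<lambda>i. a * f i + b * g i) = a \<cdot>\<^sub>m spectral P Q n f + b \<cdot>\<^sub>m spectral P Q n g"
proof -
  have "diagonal n (\<lambda>i. a * f i + b * g i) = a \<cdot>\<^sub>m diagonal n f + b \<cdot>\<^sub>m diagonal n g"
    by (intro eq_matI) (auto simp: diagonal_def)
  then show ?thesis unfolding spectral_def using P Q
    by (simp add: mult_add_distrib_mat[of _ n n _ n] add_mult_distrib_mat[of _ n n _ _ n]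
        mult_smult_distrib[of _ n n _ n] mult_smult_assoc_mat[of _ n n _ n])
qed

lemma trace_spectral: "trace_mat (spectral P Q n f) = (\<Sum>i<n. f i)"
proof -
  have "similar_mat_wit (spectral P Q n f) (diagonal n f) P Q"
    by (rule similar_mat_witI[OF PQ QP]) (use P Q in \<open>auto simp: spectral_def\<close>)
  from trace_similar[OF this spectral_carrier] show ?thesis by (simp add: trace_diagonal)
qed

lemma spectral_cong: "(\<And>i. i < n \<Longrightarrow> f i = g i) \<Longrightarrow> spectral P Q n f = spectral P Q n g"
  unfolding spectral_def diagonal_def by (intro arg_cong2[where f = "(*)"] refl eq_matI) auto

lemma spectral_inject:
  assumes "spectral P Q n f = spectral P Q n g" "i < n"
  shows "f i = g i"
proof -
  have "Q * spectral P Q n h * P = diagonal n h" for h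
  proof -
    have "Q * spectral P Q n h * P = (Q * P) * (diagonal n h * (Q * P))"
      unfolding spectral_def using P Q by (simp add: assoc)
    then show ?thesis unfolding QP by simp
  qed
  then have "diagonal n f = diagonal n g" using assms(1) by metis
  then have "diagonal n f $$ (i, i) = diagonal n g $$ (i, i)" by simp
  then show ?thesis using assms(2) by (simp add: diagonal_def)
qed

text \<open>In the eigenbasis, commuting with \<open>diag(d)\<close> means that the entry at \<open>(i, j)\<close> vanishes unless
  \<open>d i = d j\<close>; such a block matrix commutes with every diagonal matrix that is constant on the blocks.
  In particular the spectral projections commute with whatever commutes with the matrix itself.\<close>

lemma spectral_commute:
  assumes W: "W \<in> carrier_mat n n" and comm: "W * spectral P Q n d = spectral P Q n d * W"
    and f: "\<And>i j. i < n \<Longrightarrow> j < n \<Longrightarrow> d i = d j \<Longrightarrow> f i = f j"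
  shows "W * spectral P Q n f = spectral P Q n f * W"
proof -
  define Y where "Y = Q * W * P"
  have Y: "Y \<in> carrier_mat n n" using P Q W by (simp add: Y_def)
  have "P * Y * Q = (P * Q) * (W * (P * Q))"
    unfolding Y_def using P Q W by (simp add: assoc)
  then have XY: "W = P * Y * Q" unfolding PQ using W by simp
  have unconj: "Z = Z'" if "P * Z * Q = P * Z' * Q" "Z \<in> carrier_mat n n" "Z' \<in> carrier_mat n n" for Z Z'
  proof -
    have "Q * (P * V * Q) * P = V" if "V \<in> carrier_mat n n" for V
    proof -
      have "Q * (P * V * Q) * P = (Q * P) * (V * (Q * P))"
        using P Q that by (simp add: assoc)
      then show ?thesis unfolding QP using that by simp
    qed
    then show ?thesis using that by metis
  qed
  have "P * (Y * diagonal n d) * Q = P * (diagonal n d * Y) * Q"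
    using comm unfolding spectral_def XY using Y by (simp only: conjugate_mult diagonal_carrier)
  then have "Y * diagonal n d = diagonal n d * Y"
    by (rule unconj) (use Y in auto)
  then have entry: "Y $$ (i, j) * d j = d i * Y $$ (i, j)" if "i < n" "j < n" for i j
    using times_diagonal_index[OF Y that, of d] diagonal_times_index[OF Y that, of d] by metis
  have "Y * diagonal n f = diagonal n f * Y"
  proof (rule eq_matI)
    fix i j assume "i < dim_row (diagonal n f * Y)" "j < dim_col (diagonal n f * Y)"
    then have ij: "i < n" "j < n" using Y by (auto simp: diagonal_def)
    have "Y $$ (i, j) = 0 \<or> d i = d j" using entry[OF ij] by auto
    then show "(Y * diagonal n f) $$ (i, j) = (diagonal n f * Y) $$ (i, j)"
      unfolding times_diagonal_index[OF Y ij] diagonal_times_index[OF Y ij] using f[OF ij] by auto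
  qed (use Y in \<open>auto simp: diagonal_def\<close>)
  then show ?thesis unfolding spectral_def XY using Y by (simp only: conjugate_mult diagonal_carrier)
qed

end

lemma hermitian_eigenbasis:
  assumes "A \<in> carrier_mat n n" "hermitian_mat A"
  obtains P Q d where "eigenbasis P Q n" "A = spectral P Q n d"
proof -
  obtain P Q d where sim: "similar_mat_wit A (diagonal n d) P Q"
    using hermitian_diagonalisable[OF assms] by blast
  note * = similar_mat_witD2[OF assms(1) sim]
  have "eigenbasis P Q n" by unfold_locales (use * in blast)+
  then show thesis using that *(3) unfolding spectral_def by blast
qed

section \<open>The regular representation\<close>

definition point :: "'a \<Rightarrow> 'a \<Rightarrow> complex" where
  "point g h = (if h = g then 1 else 0)"

text \<open>The enumeration serves only to index the rows and columns of the matrices of the regular representation.\<close>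

locale enumerated_group = group G for G (structure) +
  fixes enum :: "nat \<Rightarrow> 'a" and n :: nat
  assumes enum: "bij_betw enum {..<n} (carrier G)"
begin

lemmas mult_closed [simp] = square_mult_closed[where n = n]
lemmas one_mult [simp] = left_mult_one_mat[of _ n n] right_mult_one_mat[of _ n n]
lemmas assoc = square_assoc[where n = n]

lemma finite_carrier: "finite (carrier G)"
  using enum bij_betw_finite by blast

lemma order_eq: "n = order G" "n > 0"
proof -
  show "n = order G" using bij_betw_same_card[OF enum] by (simp add: Coset.order_def)
  then show "n > 0" using order_gt_0_iff_finite finite_carrier by simp
qed

lemma enum_closed [simp]: "i < n \<Longrightarrow> enum i \<in> carrier G"
  using enum by (auto simp: bij_betw_def)

lemma enum_eq_iff [simp]: "i < n \<Longrightarrow> j < n \<Longrightarrow> enum i = enum j \<longleftrightarrow> i = j"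
  using enum by (auto simp: bij_betw_def inj_on_def)

lemma enum_surj: "g \<in> carrier G \<Longrightarrow> \<exists>i<n. g = enum i"
  using enum by (auto simp: bij_betw_def)

lemma sum_enum: "(\<Sum>k<n. F (enum k)) = (\<Sum>g\<in>carrier G. F g)"
  using sum.reindex_bij_betw[OF enum] .

text \<open>The product of the elements \<open>\<Sum>g. c g g\<close> and \<open>\<Sum>g. d g g\<close> of the complex group algebra.\<close>

definition conv :: "('a \<Rightarrow> complex) \<Rightarrow> ('a \<Rightarrow> complex) \<Rightarrow> 'a \<Rightarrow> complex" where
  "conv c d g = (\<Sum>h\<in>carrier G. c h * d (inv h \<otimes> g))"

text \<open>The matrix of left multiplication by \<open>\<Sum>g. c g g\<close> on the group algebra in the basis \<open>enum\<close>.\<close>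

definition reg :: "('a \<Rightarrow> complex) \<Rightarrow> complex mat" where
  "reg c = mat n n (\<lambda>(i, j). c (enum i \<otimes> inv (enum j)))"

lemma reg_carrier [simp]: "reg c \<in> carrier_mat n n"
  by (simp add: reg_def)

lemma reg_index: "i < n \<Longrightarrow> j < n \<Longrightarrow> reg c $$ (i, j) = c (enum i \<otimes> inv (enum j))"
  by (simp add: reg_def)

lemma reg_cong: "(\<And>g. g \<in> carrier G \<Longrightarrow> c g = d g) \<Longrightarrow> reg c = reg d"
  by (intro eq_matI) (auto simp: reg_def)

lemma reg_inject:
  assumes "reg c = reg d" "g \<in> carrier G"
  shows "c g = d g"
proof -
  obtain i j where ij: "i < n" "j < n" "g = enum i" "\<one> = enum j" using enum_surj assms(2) one_closed by metis
  have "c (enum i \<otimes> inv (enum j)) = d (enum i \<otimes> inv (enum j))"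
    using reg_index[OF ij(1,2)] assms(1) by metis
  then show ?thesis using ij(3,4)[symmetric] assms(2) by simp
qed

lemma reg_mult: "reg c * reg d = reg (conv c d)"
proof (rule eq_matI)
  fix i j assume "i < dim_row (reg (conv c d))" "j < dim_col (reg (conv c d))"
  then have ij: "i < n" "j < n" by (auto simp: reg_def)
  let ?x = "enum i" and ?y = "enum j"
  have xy: "?x \<in> carrier G" "?y \<in> carrier G" using ij by simp_all
  have "(reg c * reg d) $$ (i, j) = (\<Sum>k<n. reg c $$ (i, k) * reg d $$ (k, j))"
    by (rule mat_mult_index_sum) (use ij in auto)
  also have "\<dots> = (\<Sum>k<n. c (?x \<otimes> inv (enum k)) * d (enum k \<otimes> inv ?y))"
    using ij by (intro sum.cong) (auto simp: reg_index)
  also have "\<dots> = (\<Sum>g\<in>carrier G. c (?x \<otimes> inv g) * d (g \<otimes> inv ?y))" by (rule sum_enum)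
  also have "\<dots> = (\<Sum>h\<in>carrier G. c h * d (inv h \<otimes> (?x \<otimes> inv ?y)))"
    by (rule sum.reindex_bij_witness[of _ "\<lambda>h. inv h \<otimes> ?x" "\<lambda>g. ?x \<otimes> inv g"])
      (use xy in \<open>auto simp: inv_mult_group m_assoc inv_solve_left' m_assoc[symmetric]\<close>)
  finally show "(reg c * reg d) $$ (i, j) = reg (conv c d) $$ (i, j)"
    using ij by (simp add: reg_index conv_def)
qed (auto simp: reg_def)

lemma conv_point_left:
  assumes "h \<in> carrier G" shows "conv (point h) d g = d (inv h \<otimes> g)"
proof -
  have "conv (point h) d g = (\<Sum>k\<in>carrier G. if k = h then d (inv h \<otimes> g) else 0)"
    unfolding conv_def by (intro sum.cong) (auto simp: point_def)
  then show ?thesis using assms finite_carrier by simp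
qed

lemma conv_point_right:
  assumes "h \<in> carrier G" "g \<in> carrier G" shows "conv c (point h) g = c (g \<otimes> inv h)"
proof -
  have "conv c (point h) g = (\<Sum>k\<in>carrier G. if k = g \<otimes> inv h then c (g \<otimes> inv h) else 0)"
    unfolding conv_def
  proof (intro sum.cong refl)
    fix k assume k: "k \<in> carrier G"
    have "inv k \<otimes> g = h \<longleftrightarrow> k = g \<otimes> inv h"
      using assms k by (metis inv_closed inv_equality inv_inv inv_solve_left inv_solve_right)
    then show "c k * point h (inv k \<otimes> g) = (if k = g \<otimes> inv h then c (g \<otimes> inv h) else 0)"
      by (auto simp: point_def)
  qed
  then show ?thesis using assms finite_carrier by simp
qed

lemma reg_point_one: "reg (point \<one>) = 1\<^sub>m n"
proof (rule eq_matI)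
  fix i j assume "i < dim_row (1\<^sub>m n :: complex mat)" "j < dim_col (1\<^sub>m n :: complex mat)"
  then have ij: "i < n" "j < n" by auto
  have "enum i \<otimes> inv (enum j) = \<one> \<longleftrightarrow> enum i = enum j"
    using ij by (metis enum_closed inv_equality inv_inv r_inv inv_closed)
  then show "reg (point \<one>) $$ (i, j) = 1\<^sub>m n $$ (i, j)"
    using ij by (auto simp: reg_index point_def)
qed (auto simp: reg_def)

lemma reg_point_mult:
  assumes "g \<in> carrier G" "h \<in> carrier G"
  shows "reg (point g) * reg (point h) = reg (point (g \<otimes> h))"
  unfolding reg_mult
proof (rule reg_cong)
  fix k assume k: "k \<in> carrier G"
  have "inv g \<otimes> k = h \<longleftrightarrow> k = g \<otimes> h" using assms k inv_solve_left' by metis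
  then show "conv (point g) (point h) k = point (g \<otimes> h) k"
    unfolding conv_point_left[OF assms(1)] point_def by simp
qed

lemma reg_point_pow:
  assumes "g \<in> carrier G"
  shows "reg (point g) ^\<^sub>m k = reg (point (g [^] k))"
proof (induction k)
  case 0
  then show ?case using carrier_matD(1)[OF reg_carrier[of "point g"]] by (simp add: reg_point_one)
next
  case (Suc k)
  then show ?case using assms by (simp add: reg_point_mult)
qed

lemma reg_class_function_commute:
  assumes c: "\<And>g h. g \<in> carrier G \<Longrightarrow> h \<in> carrier G \<Longrightarrow> c (h \<otimes> g \<otimes> inv h) = c g"
    and h: "h \<in> carrier G"
  shows "reg c * reg (point h) = reg (point h) * reg c"
  unfolding reg_mult
proof (rule reg_cong)
  fix g assume g: "g \<in> carrier G"
  have "c (h \<otimes> (inv h \<otimes> g) \<otimes> inv h) = c (inv h \<otimes> g)" by (rule c) (use g h in auto)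
  moreover have "h \<otimes> (inv h \<otimes> g) = g" using g h by (simp add: m_assoc[symmetric])
  ultimately show "conv c (point h) g = conv (point h) c g"
    using g h by (simp add: conv_point_left conv_point_right)
qed

lemma reg_transpose: "transpose_mat (reg c) = reg (\<lambda>g. c (inv g))"
  by (rule eq_matI) (auto simp: reg_def inv_mult_group)

lemma hermitian_reg:
  assumes "\<And>g. g \<in> carrier G \<Longrightarrow> c (inv g) = cnj (c g)"
  shows "hermitian_mat (reg c)"
  unfolding hermitian_mat_def
proof (intro allI impI)
  fix i j assume "i < dim_row (reg c)" "j < dim_row (reg c)"
  then have ij: "i < n" "j < n" by (auto simp: reg_def)
  have "c (inv (enum i \<otimes> inv (enum j))) = cnj (c (enum i \<otimes> inv (enum j)))" by (rule assms) (use ij in simp)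
  then show "reg c $$ (j, i) = cnj (reg c $$ (i, j))"
    using ij by (simp add: reg_index inv_mult_group)
qed

lemma reg_linear: "a \<cdot>\<^sub>m reg c + b \<cdot>\<^sub>m reg d = reg (\<lambda>g. a * c g + b * d g)"
  by (rule eq_matI) (auto simp: reg_def)

text \<open>In the regular representation the trace picks out the coefficient of the identity.\<close>

lemma trace_reg: "trace_mat (reg c) = of_nat n * c \<one>"
  by (simp add: trace_mat_def reg_def)

text \<open>Linearity of \<open>c \<mapsto> reg c\<close>, in the form in which traces are expanded into character values below.\<close>

lemma trace_reg_mult:
  assumes M: "M \<in> carrier_mat n n"
  shows "trace_mat (reg c * M) = (\<Sum>g\<in>carrier G. c g * trace_mat (reg (point g) * M))"
proof -
  have tr: "trace_mat (reg d * M) = (\<Sum>i<n. \<Sum>k<n. d (enum i \<otimes> inv (enum k)) * M $$ (k, i))" for d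
  proof -
    have "trace_mat (reg d * M) = (\<Sum>i<n. (reg d * M) $$ (i, i))"
      by (simp add: trace_mat_def reg_def)
    also have "\<dots> = (\<Sum>i<n. \<Sum>k<n. reg d $$ (i, k) * M $$ (k, i))"
      by (intro sum.cong refl mat_mult_index_sum) (use M in auto)
    finally show ?thesis by (simp add: reg_index)
  qed
  have "(\<Sum>g\<in>carrier G. c g * trace_mat (reg (point g) * M))
      = (\<Sum>g\<in>carrier G. \<Sum>i<n. \<Sum>k<n. c g * (point g (enum i \<otimes> inv (enum k)) * M $$ (k, i)))"
    unfolding tr by (simp add: sum_distrib_left)
  also have "\<dots> = (\<Sum>i<n. \<Sum>k<n. \<Sum>g\<in>carrier G. c g * (point g (enum i \<otimes> inv (enum k)) * M $$ (k, i)))"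
    by (subst sum.swap, intro sum.cong refl, subst sum.swap, rule refl)
  also have "\<dots> = (\<Sum>i<n. \<Sum>k<n. c (enum i \<otimes> inv (enum k)) * M $$ (k, i))"
  proof (intro sum.cong refl)
    fix i k assume "i \<in> {..<n}" "k \<in> {..<n}"
    then have ik: "enum i \<otimes> inv (enum k) \<in> carrier G" by simp
    have "(\<Sum>g\<in>carrier G. c g * (point g (enum i \<otimes> inv (enum k)) * M $$ (k, i)))
        = (\<Sum>g\<in>carrier G. if enum i \<otimes> inv (enum k) = g then c (enum i \<otimes> inv (enum k)) * M $$ (k, i) else 0)"
      by (intro sum.cong) (auto simp: point_def)
    then show "(\<Sum>g\<in>carrier G. c g * (point g (enum i \<otimes> inv (enum k)) * M $$ (k, i)))
        = c (enum i \<otimes> inv (enum k)) * M $$ (k, i)" using ik finite_carrier by simp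
  qed
  also have "\<dots> = trace_mat (reg c * M)" by (rule tr[symmetric])
  finally show ?thesis ..
qed

section \<open>Characters of central idempotents\<close>

text \<open>For such a projection \<open>e\<close>, the image of \<open>e\<close> is a \<open>G\<close>-invariant subspace and \<open>character e\<close> is its character.\<close>

definition invariant_projection :: "complex mat \<Rightarrow> bool" where
  "invariant_projection e \<longleftrightarrow> e \<in> carrier_mat n n \<and> e * e = e \<and>
    (\<forall>g\<in>carrier G. reg (point g) * e = e * reg (point g))"

definition character :: "complex mat \<Rightarrow> 'a \<Rightarrow> complex" where
  "character e g = trace_mat (reg (point g) * e)"

text \<open>The matrix \<open>M\<close> of \<open>g\<close> times \<open>e\<close> satisfies \<open>M\<^sup>j = g\<^sup>j e\<close> for \<open>j \<ge> 1\<close>, so \<open>M\<^bsup>N+1\<^esup> = M\<close> and every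
  eigenvalue of \<open>M\<close> is 0 or an \<open>N\<close>-th root of unity. The exponent \<open>j = 0\<close> is excluded, where the zero eigenvalues
  outside the image of \<open>e\<close> would be counted as 1.\<close>

lemma character_powers:
  assumes e: "invariant_projection e" and g: "g \<in> carrier G" and o: "g [^] N = \<one>"
  obtains b where "\<And>j. j \<ge> 1 \<Longrightarrow> character e (g [^] j) = (\<Sum>i<n. b i ^ j)"
    and "\<And>i. i < n \<Longrightarrow> b i = 0 \<or> b i ^ N = 1"
proof -
  define M where "M = reg (point g) * e"
  have ec: "e \<in> carrier_mat n n" "e * e = e" "reg (point g) * e = e * reg (point g)"
    using e g by (auto simp: invariant_projection_def)
  have M: "M \<in> carrier_mat n n" using ec by (simp add: M_def)
  have Mj: "M ^\<^sub>m (Suc j) = reg (point (g [^] Suc j)) * e" for j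
  proof (induction j)
    case 0
    then show ?case using g ec by (simp add: M_def)
  next
    case (Suc j)
    let ?R = "reg (point (g [^] Suc j))" and ?S = "reg (point g)"
    have "M ^\<^sub>m (Suc (Suc j)) = (?R * e) * (?S * e)" using Suc by (simp add: M_def)
    also have "\<dots> = ?R * ((e * ?S) * e)" using ec(1) by (simp only: assoc reg_carrier mult_closed)
    also have "\<dots> = ?R * ((?S * e) * e)" using ec(3) by simp
    also have "\<dots> = (?R * ?S) * (e * e)" using ec(1) by (simp only: assoc reg_carrier mult_closed)
    also have "\<dots> = reg (point (g [^] Suc (Suc j))) * e"
      using ec(2) reg_point_mult[of "g [^] Suc j" g] g by simp
    finally show ?case .
  qed
  obtain b where b: "\<And>k. trace_mat (M ^\<^sub>m k) = (\<Sum>i<n. b i ^ k)"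
    "\<And>k l i. M ^\<^sub>m k = M ^\<^sub>m l \<Longrightarrow> i < n \<Longrightarrow> b i ^ k = b i ^ l"
    using trace_powers[OF M] by blast
  have "g [^] Suc N = g [^] Suc 0" using o g by simp
  then have per: "M ^\<^sub>m (Suc N) = M ^\<^sub>m (Suc 0)" unfolding Mj by simp
  show thesis
  proof (rule that)
    fix j :: nat assume "j \<ge> 1"
    then obtain i where "j = Suc i" by (cases j) auto
    then show "character e (g [^] j) = (\<Sum>i<n. b i ^ j)"
      using b(1)[of j] Mj[of i] by (simp add: character_def)
  next
    fix i assume "i < n"
    then have "b i ^ Suc N = b i ^ Suc 0" using b(2)[OF per] by blast
    then show "b i = 0 \<or> b i ^ N = 1" by auto
  qed
qed

text \<open>Reduces weighted sums of character values along the powers of \<open>g\<close> to the same sums over the powers of a single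
  root of unity or of 0.\<close>

lemma character_weighted_sum:
  assumes e: "invariant_projection e" and g: "g \<in> carrier G" and o: "g [^] N = \<one>" and w: "w 0 = 0"
    and s: "\<And>b::complex. b = 0 \<or> b ^ N = 1 \<Longrightarrow> \<exists>z::int. (\<Sum>j<N. w j * b ^ j) = of_int z * c"
  shows "\<exists>z::int. (\<Sum>j<N. w j * character e (g [^] j)) = of_int z * c"
proof -
  obtain b where b: "\<And>j. j \<ge> 1 \<Longrightarrow> character e (g [^] j) = (\<Sum>i<n. b i ^ j)"
    "\<And>i. i < n \<Longrightarrow> b i = 0 \<or> b i ^ N = 1"
    using character_powers[OF e g o] by blast
  obtain z :: "nat \<Rightarrow> int" where z: "\<And>i. i < n \<Longrightarrow> (\<Sum>j<N. w j * b i ^ j) = of_int (z i) * c"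
    using s[OF b(2)] by metis
  have "(\<Sum>j<N. w j * character e (g [^] j)) = (\<Sum>j<N. \<Sum>i<n. w j * b i ^ j)"
  proof (intro sum.cong refl)
    fix j show "w j * character e (g [^] j) = (\<Sum>i<n. w j * b i ^ j)"
      using b(1)[of j] w by (cases "j = 0") (simp_all add: sum_distrib_left)
  qed
  also have "\<dots> = (\<Sum>i<n. \<Sum>j<N. w j * b i ^ j)" by (rule sum.swap)
  also have "\<dots> = of_int (\<Sum>i<n. z i) * c" by (simp add: z sum_distrib_right)
  finally show ?thesis by blast
qed

lemma character_conjugate:
  assumes e: "invariant_projection e" and g: "g \<in> carrier G" and h: "h \<in> carrier G"
  shows "character e (h \<otimes> g \<otimes> inv h) = character e g"
proof -
  have ec: "e \<in> carrier_mat n n" "reg (point (inv h)) * e = e * reg (point (inv h))"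
    using e h by (auto simp: invariant_projection_def)
  let ?H = "reg (point h)" and ?K = "reg (point (inv h))" and ?g = "reg (point g)"
  have "reg (point (h \<otimes> g \<otimes> inv h)) * e = (?H * ?g) * (?K * e)"
    using g h ec(1) by (simp add: reg_point_mult[symmetric] assoc_mult_mat[of _ n n _ n _ n])
  also have "\<dots> = (?H * (?g * e)) * ?K"
    unfolding ec(2) using ec(1) by (simp add: assoc)
  finally have "character e (h \<otimes> g \<otimes> inv h) = trace_mat (?K * (?H * (?g * e)))"
    unfolding character_def using ec(1) trace_mult_commute[of "?H * (?g * e)" n ?K] by simp
  also have "?K * (?H * (?g * e)) = (?K * ?H) * (?g * e)"
    using ec(1) by (simp add: assoc)
  also have "?K * ?H = 1\<^sub>m n" using h reg_point_mult[of "inv h" h] reg_point_one by simp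
  finally show ?thesis using ec(1) by (simp add: character_def)
qed

end

section \<open>Conjugacy of powers\<close>

context group
begin

lemma inv_cancel:
  assumes "g \<in> carrier G" "x \<in> carrier G"
  shows "inv g \<otimes> (g \<otimes> x) = x" and "g \<otimes> (inv g \<otimes> x) = x"
  using assms by (simp_all flip: m_assoc)

lemma conj_pow:
  assumes "g \<in> carrier G" "x \<in> carrier G"
  shows "(g \<otimes> x \<otimes> inv g) [^] (k::nat) = g \<otimes> x [^] k \<otimes> inv g"
proof (induction k)
  case (Suc k)
  have "(g \<otimes> x [^] k \<otimes> inv g) \<otimes> (g \<otimes> x \<otimes> inv g) = g \<otimes> x [^] k \<otimes> ((inv g \<otimes> g) \<otimes> (x \<otimes> inv g))"
    using assms by (simp add: m_assoc inv_cancel)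
  then show ?case using Suc assms by (simp add: m_assoc inv_cancel)
qed (use assms in simp)

lemma conjugate_in_refl: "x \<in> carrier G \<Longrightarrow> conjugate_in G x x"
  unfolding conjugate_in_def by (intro bexI[of _ \<one>]) auto

lemma conjugate_in_sym:
  assumes "conjugate_in G x y" "x \<in> carrier G"
  shows "conjugate_in G y x"
proof -
  obtain g where g: "g \<in> carrier G" "y = g \<otimes> x \<otimes> inv g" using assms unfolding conjugate_in_def by blast
  have "x = inv g \<otimes> y \<otimes> inv (inv g)"
    using g assms(2) by (simp add: m_assoc inv_cancel)
  then show ?thesis using g unfolding conjugate_in_def by blast
qed

lemma conjugate_in_trans:
  assumes "conjugate_in G x y" "conjugate_in G y z" "x \<in> carrier G"
  shows "conjugate_in G x z"
proof -
  obtain g where g: "g \<in> carrier G" "y = g \<otimes> x \<otimes> inv g" using assms unfolding conjugate_in_def by blast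
  obtain h where h: "h \<in> carrier G" "z = h \<otimes> y \<otimes> inv h" using assms unfolding conjugate_in_def by blast
  have "z = (h \<otimes> g) \<otimes> x \<otimes> inv (h \<otimes> g)" using g h assms(3) by (simp add: m_assoc inv_mult_group)
  then show ?thesis using g h unfolding conjugate_in_def by blast
qed

lemma conjugate_in_pow:
  assumes "conjugate_in G x y" "x \<in> carrier G"
  shows "conjugate_in G (x [^] (k::nat)) (y [^] k)"
  using assms conj_pow unfolding conjugate_in_def by blast

lemma conjugate_in_inv:
  assumes "conjugate_in G x y" "x \<in> carrier G"
  shows "conjugate_in G (inv x) (inv y)"
proof -
  obtain g where g: "g \<in> carrier G" "y = g \<otimes> x \<otimes> inv g" using assms unfolding conjugate_in_def by blast
  have "inv y = g \<otimes> inv x \<otimes> inv g" using g assms(2) by (simp add: m_assoc inv_mult_group)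
  then show ?thesis using g unfolding conjugate_in_def by blast
qed

text \<open>In a finite group this says that the real parts of all characters agree at \<open>x\<close> and \<open>y\<close>; for \<open>y = x\<^sup>3\<close> it is
  the condition on \<open>x\<close> that characterises the cut-property of 2-groups.\<close>

definition real_conjugate :: "'a \<Rightarrow> 'a \<Rightarrow> bool" where
  "real_conjugate y x \<longleftrightarrow> conjugate_in G y x \<or> conjugate_in G y (inv x)"

lemma real_conjugate_inv:
  assumes "real_conjugate y x" "x \<in> carrier G" "y \<in> carrier G"
  shows "real_conjugate (inv y) x"
  using assms conjugate_in_inv[of y x] conjugate_in_inv[of y "inv x"] by (auto simp: real_conjugate_def)

lemma real_conjugate_power_mult:
  assumes x: "x \<in> carrier G" and i: "real_conjugate (x [^] (i::nat)) x" and j: "real_conjugate (x [^] (j::nat)) x"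
  shows "real_conjugate (x [^] (i * j)) x"
proof -
  have pj: "x [^] (i * j) = (x [^] i) [^] j" using x by (simp add: nat_pow_pow)
  have "conjugate_in G (x [^] (i * j)) (x [^] j) \<or> conjugate_in G (x [^] (i * j)) (inv (x [^] j))"
    using i conjugate_in_pow[of "x [^] i" x j] conjugate_in_pow[of "x [^] i" "inv x" j] x
    unfolding real_conjugate_def pj by (auto simp: nat_pow_inv)
  moreover have "real_conjugate (inv (x [^] j)) x" using real_conjugate_inv[OF j] x by simp
  ultimately show ?thesis
    using j conjugate_in_trans[of "x [^] (i * j)"] x unfolding real_conjugate_def by (meson nat_pow_closed)
qed

lemma real_conjugate_power_power:
  assumes x: "x \<in> carrier G" and i: "real_conjugate (x [^] (i::nat)) x"
  shows "real_conjugate (x [^] (i ^ k)) x"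
proof (induction k)
  case 0
  then show ?case using x conjugate_in_refl by (simp add: real_conjugate_def)
next
  case (Suc k)
  then show ?case using real_conjugate_power_mult[OF x i] by simp
qed

lemma pow_eq_one_of_dvd:
  assumes "x \<in> carrier G" "x [^] (N::nat) = \<one>" "N dvd a"
  shows "x [^] a = \<one>"
  using assms by (auto elim!: dvdE simp flip: nat_pow_pow)

lemma pow_mod_eq:
  assumes "x \<in> carrier G" "x [^] (N::nat) = \<one>" "a mod N = b mod N"
  shows "x [^] a = x [^] b"
proof -
  have "x [^] a = x [^] (a mod N)" for a
  proof -
    have "x [^] (N * (a div N) + a mod N) = x [^] (N * (a div N)) \<otimes> x [^] (a mod N)"
      using assms(1) by (simp add: nat_pow_mult)
    also have "x [^] (N * (a div N)) = \<one>" by (rule pow_eq_one_of_dvd[OF assms(1,2)]) simp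
    finally show ?thesis using assms(1) by simp
  qed
  then show ?thesis using assms(3) by metis
qed

text \<open>The exponents \<open>a\<close> with \<open>x\<^sup>a\<close> conjugate to \<open>x\<close> or to its inverse form a subgroup of the odd residues that contains \<open>-1\<close>,
  and \<open>-1\<close> and \<open>j\<close> generate all odd residues. So the condition for one such \<open>j\<close>, such as 3,
  gives it for every odd exponent.\<close>

lemma real_conjugate_odd_power:
  assumes x: "x \<in> carrier G" and o: "x [^] ((2::nat) ^ m) = \<one>"
    and j: "j mod 8 = 3 \<or> j mod 8 = 5" "real_conjugate (x [^] (j::nat)) x" and a: "odd (a::nat)"
  shows "real_conjugate (x [^] a) x"
proof -
  have "int j mod 8 = int (j mod 8)" by (simp add: zmod_int)
  with j(1) have "int j mod 8 = 3 \<or> int j mod 8 = 5" by auto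
  from odd_eq_pm_power[OF this, of "int a" m] a obtain k
    where "2 ^ m dvd int a - int j ^ k \<or> 2 ^ m dvd int a + int j ^ k" by auto
  then show ?thesis
  proof
    assume "2 ^ m dvd int a - int j ^ k"
    then have "int a mod 2 ^ m = int j ^ k mod 2 ^ m" by (simp add: mod_eq_dvd_iff)
    then have "int (a mod 2 ^ m) = int (j ^ k mod 2 ^ m)" by (simp add: zmod_int)
    then have "a mod 2 ^ m = j ^ k mod 2 ^ m" by (simp only: of_nat_eq_iff)
    then have "x [^] a = x [^] (j ^ k)" by (rule pow_mod_eq[OF x o])
    then show ?thesis using real_conjugate_power_power[OF x j(2)] by simp
  next
    assume "2 ^ m dvd int a + int j ^ k"
    then have "int (2 ^ m) dvd int (a + j ^ k)" by simp
    then have "2 ^ m dvd a + j ^ k" unfolding int_dvd_int_iff .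
    then have "x [^] a \<otimes> x [^] (j ^ k) = \<one>" using pow_eq_one_of_dvd[OF x o] x by (simp add: nat_pow_mult)
    then have "x [^] a = inv (x [^] (j ^ k))" using x by (simp add: inv_equality)
    then show ?thesis using real_conjugate_inv[OF real_conjugate_power_power[OF x j(2)]] x by simp
  qed
qed

end

section \<open>Central units of the integral group ring\<close>

definition coef :: "('a \<Rightarrow>\<^sub>0 int) \<Rightarrow> 'a \<Rightarrow> complex" where
  "coef a g = of_int (Poly_Mapping.lookup a g)"

context enumerated_group
begin

abbreviation "ZG \<equiv> integral_group_ring G"

lemma ZG_simps [simp]:
  "a \<in> carrier ZG \<longleftrightarrow> Poly_Mapping.keys a \<subseteq> carrier G"
  "\<one>\<^bsub>ZG\<^esub> = Poly_Mapping.single \<one> 1"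
  by (simp_all add: integral_group_ring_def)

lemma lookup_ZG_mult:
  assumes a: "a \<in> carrier ZG" and b: "b \<in> carrier ZG" and x: "x \<in> carrier G"
  shows "Poly_Mapping.lookup (a \<otimes>\<^bsub>ZG\<^esub> b) x
    = (\<Sum>g\<in>carrier G. Poly_Mapping.lookup a g * Poly_Mapping.lookup b (inv g \<otimes> x))"
proof -
  let ?a = "Poly_Mapping.lookup a" and ?b = "Poly_Mapping.lookup b"
  have "Poly_Mapping.lookup (a \<otimes>\<^bsub>ZG\<^esub> b) x
      = (\<Sum>g\<in>Poly_Mapping.keys a. \<Sum>h\<in>Poly_Mapping.keys b. if g \<otimes> h = x then ?a g * ?b h else 0)"
    by (simp add: integral_group_ring_def lookup_sum lookup_single when_def)
  also have "\<dots> = (\<Sum>g\<in>carrier G. \<Sum>h\<in>Poly_Mapping.keys b. if g \<otimes> h = x then ?a g * ?b h else 0)"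
    by (rule sum.mono_neutral_left) (use a finite_carrier in \<open>auto simp: in_keys_iff intro!: sum.neutral\<close>)
  also have "\<dots> = (\<Sum>g\<in>carrier G. ?a g * ?b (inv g \<otimes> x))"
  proof (intro sum.cong refl)
    fix g assume g: "g \<in> carrier G"
    have "(\<Sum>h\<in>Poly_Mapping.keys b. if g \<otimes> h = x then ?a g * ?b h else 0)
        = (\<Sum>h\<in>carrier G. if g \<otimes> h = x then ?a g * ?b h else 0)"
      by (rule sum.mono_neutral_left) (use b finite_carrier in \<open>auto simp: in_keys_iff\<close>)
    also have "\<dots> = (\<Sum>h\<in>carrier G. if h = inv g \<otimes> x then ?a g * ?b (inv g \<otimes> x) else 0)"
    proof (intro sum.cong refl)
      fix h assume h: "h \<in> carrier G"
      have "g \<otimes> h = x \<longleftrightarrow> h = inv g \<otimes> x" using g h x inv_solve_left by metis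
      then show "(if g \<otimes> h = x then ?a g * ?b h else 0) = (if h = inv g \<otimes> x then ?a g * ?b (inv g \<otimes> x) else 0)"
        by simp
    qed
    finally show "(\<Sum>h\<in>Poly_Mapping.keys b. if g \<otimes> h = x then ?a g * ?b h else 0) = ?a g * ?b (inv g \<otimes> x)"
      using g x finite_carrier by simp
  qed
  finally show ?thesis .
qed

lemma ZG_mult_closed:
  assumes a: "a \<in> carrier ZG" and b: "b \<in> carrier ZG"
  shows "a \<otimes>\<^bsub>ZG\<^esub> b \<in> carrier ZG"
proof -
  have "Poly_Mapping.lookup (a \<otimes>\<^bsub>ZG\<^esub> b) x = 0" if "x \<notin> carrier G" for x
  proof -
    have "g \<otimes> h \<noteq> x" if "g \<in> Poly_Mapping.keys a" "h \<in> Poly_Mapping.keys b" for g h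
      using that a b \<open>x \<notin> carrier G\<close> by auto
    then show ?thesis
      by (simp add: integral_group_ring_def lookup_sum lookup_single when_def)
  qed
  then show ?thesis by (auto simp: in_keys_iff)
qed

lemma reg_coef_mult:
  assumes "a \<in> carrier ZG" "b \<in> carrier ZG"
  shows "reg (coef (a \<otimes>\<^bsub>ZG\<^esub> b)) = reg (coef a) * reg (coef b)"
  unfolding reg_mult by (rule reg_cong) (simp add: coef_def lookup_ZG_mult[OF assms] conv_def)

lemma coef_single: "coef (Poly_Mapping.single g k) h = of_int k * point g h"
  by (simp add: coef_def lookup_single when_def point_def)

lemma reg_coef_single: "reg (coef (Poly_Mapping.single g 1)) = reg (point g)"
  by (rule reg_cong) (simp add: coef_single)

lemma reg_coef_inject:
  assumes "a \<in> carrier ZG" "b \<in> carrier ZG" "reg (coef a) = reg (coef b)"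
  shows "a = b"
proof (rule poly_mapping_eqI)
  fix x
  show "Poly_Mapping.lookup a x = Poly_Mapping.lookup b x"
  proof (cases "x \<in> carrier G")
    case True
    then show ?thesis using reg_inject[OF assms(3)] by (simp add: coef_def)
  next
    case False
    then have "x \<notin> Poly_Mapping.keys a" "x \<notin> Poly_Mapping.keys b" using assms(1,2) by auto
    then show ?thesis by (simp add: in_keys_iff)
  qed
qed

lemma ZG_element_of_integral:
  assumes "\<And>g. g \<in> carrier G \<Longrightarrow> c g \<in> \<int>"
  obtains a where "a \<in> carrier ZG" "reg (coef a) = reg c"
proof -
  obtain k :: "'a \<Rightarrow> int" where k: "\<And>g. g \<in> carrier G \<Longrightarrow> c g = of_int (k g)"
  proof -
    have "\<forall>g. \<exists>k::int. g \<in> carrier G \<longrightarrow> c g = of_int k" using assms by (blast elim: Ints_cases)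
    then show thesis using that by metis
  qed
  define a where "a = (\<Sum>g\<in>carrier G. Poly_Mapping.single g (k g))"
  have la: "Poly_Mapping.lookup a x = (if x \<in> carrier G then k x else 0)" for x
    using finite_carrier by (simp add: a_def lookup_sum lookup_single when_def)
  show thesis
  proof (rule that)
    show "a \<in> carrier ZG" using la by (auto simp: in_keys_iff split: if_splits)
    show "reg (coef a) = reg c" by (rule reg_cong) (simp add: coef_def la k)
  qed
qed

lemma ZG_units_iff:
  "u \<in> carrier (units_of ZG) \<longleftrightarrow> u \<in> carrier ZG \<and>
    (\<exists>w\<in>carrier ZG. w \<otimes>\<^bsub>ZG\<^esub> u = \<one>\<^bsub>ZG\<^esub> \<and> u \<otimes>\<^bsub>ZG\<^esub> w = \<one>\<^bsub>ZG\<^esub>)"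
  by (simp only: units_of_carrier Units_def mem_Collect_eq)

lemma single_unit:
  assumes "g \<in> carrier G"
  shows "Poly_Mapping.single g 1 \<in> carrier (units_of ZG)"
  unfolding ZG_units_iff
proof (intro conjI bexI[of _ "Poly_Mapping.single (inv g) 1"])
  have *: "Poly_Mapping.single h (1::int) \<in> carrier ZG" if "h \<in> carrier G" for h using that by simp
  show "Poly_Mapping.single g 1 \<in> carrier ZG" "Poly_Mapping.single (inv g) 1 \<in> carrier ZG"
    using assms by simp_all
  have "reg (coef (Poly_Mapping.single x (1::int) \<otimes>\<^bsub>ZG\<^esub> Poly_Mapping.single y 1)) = reg (coef (Poly_Mapping.single (x \<otimes> y) 1))"
    if "x \<in> carrier G" "y \<in> carrier G" for x y
    unfolding reg_coef_mult[OF *[OF that(1)] *[OF that(2)]] reg_coef_single using that by (rule reg_point_mult)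
  from reg_coef_inject[OF ZG_mult_closed[OF * *] * this]
  have mult: "Poly_Mapping.single x (1::int) \<otimes>\<^bsub>ZG\<^esub> Poly_Mapping.single y 1 = Poly_Mapping.single (x \<otimes> y) 1"
    if "x \<in> carrier G" "y \<in> carrier G" for x y using that by blast
  show "Poly_Mapping.single (inv g) 1 \<otimes>\<^bsub>ZG\<^esub> Poly_Mapping.single g 1 = \<one>\<^bsub>ZG\<^esub>"
    "Poly_Mapping.single g 1 \<otimes>\<^bsub>ZG\<^esub> Poly_Mapping.single (inv g) 1 = \<one>\<^bsub>ZG\<^esub>"
    using assms mult by simp_all
qed

text \<open>Translates central units into matrices. The group elements are themselves units, so a central
  unit commutes with them; conversely that makes it commute with the whole group ring.\<close>

lemma central_unit_iff:
  "u \<in> group_centre (units_of ZG) \<longleftrightarrow> u \<in> carrier ZG \<and>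
    (\<exists>w\<in>carrier ZG. reg (coef w) * reg (coef u) = 1\<^sub>m n \<and> reg (coef u) * reg (coef w) = 1\<^sub>m n) \<and>
    (\<forall>g\<in>carrier G. reg (coef u) * reg (point g) = reg (point g) * reg (coef u))"
    (is "?L \<longleftrightarrow> ?R")
proof
  have one: "reg (coef (\<one>\<^bsub>ZG\<^esub>)) = 1\<^sub>m n" using reg_coef_single[of \<one>] reg_point_one by simp
  {
    assume ?L
    then have u: "u \<in> carrier (units_of ZG)"
      and comm: "\<And>x. x \<in> carrier (units_of ZG) \<Longrightarrow> u \<otimes>\<^bsub>ZG\<^esub> x = x \<otimes>\<^bsub>ZG\<^esub> u"
      by (auto simp: group_centre_def units_of_mult)
    from u have uc: "u \<in> carrier ZG" unfolding ZG_units_iff by blast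
    obtain w where w: "w \<in> carrier ZG" "w \<otimes>\<^bsub>ZG\<^esub> u = \<one>\<^bsub>ZG\<^esub>" "u \<otimes>\<^bsub>ZG\<^esub> w = \<one>\<^bsub>ZG\<^esub>"
      using u unfolding ZG_units_iff by blast
    have "reg (coef w) * reg (coef u) = 1\<^sub>m n" "reg (coef u) * reg (coef w) = 1\<^sub>m n"
      unfolding reg_coef_mult[OF w(1) uc, symmetric] reg_coef_mult[OF uc w(1), symmetric] w(2,3) one by simp_all
    moreover have "reg (coef u) * reg (point g) = reg (point g) * reg (coef u)" if g: "g \<in> carrier G" for g
    proof -
      have sg: "Poly_Mapping.single g (1::int) \<in> carrier ZG" using g by simp
      show ?thesis
        unfolding reg_coef_single[symmetric] reg_coef_mult[OF uc sg, symmetric] reg_coef_mult[OF sg uc, symmetric]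
          comm[OF single_unit[OF g]] by simp
    qed
    ultimately show ?R using uc w(1) by blast
  next
    assume R: ?R
    then obtain w where uc: "u \<in> carrier ZG" and wc: "w \<in> carrier ZG"
      and w: "reg (coef w) * reg (coef u) = 1\<^sub>m n" "reg (coef u) * reg (coef w) = 1\<^sub>m n"
      by blast
    have oc: "\<one>\<^bsub>ZG\<^esub> \<in> carrier ZG" by simp
    have "w \<otimes>\<^bsub>ZG\<^esub> u = \<one>\<^bsub>ZG\<^esub>"
      by (rule reg_coef_inject[OF ZG_mult_closed[OF wc uc] oc]) (simp only: reg_coef_mult[OF wc uc] w one)
    moreover have "u \<otimes>\<^bsub>ZG\<^esub> w = \<one>\<^bsub>ZG\<^esub>"
      by (rule reg_coef_inject[OF ZG_mult_closed[OF uc wc] oc]) (simp only: reg_coef_mult[OF uc wc] w one)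
    ultimately have u: "u \<in> carrier (units_of ZG)" using uc wc unfolding ZG_units_iff by blast
    have class_fun: "coef u (h \<otimes> g) = coef u (g \<otimes> h)" if "g \<in> carrier G" "h \<in> carrier G" for g h
    proof -
      have "reg (conv (coef u) (point (inv h))) = reg (conv (point (inv h)) (coef u))"
        using R that unfolding reg_mult[symmetric] by simp
      from reg_inject[OF this, of g] show ?thesis
        using that by (simp add: conv_point_left conv_point_right)
    qed
    have "u \<otimes>\<^bsub>ZG\<^esub> x = x \<otimes>\<^bsub>ZG\<^esub> u" if "x \<in> carrier (units_of ZG)" for x
    proof -
      have xc: "x \<in> carrier ZG" using that unfolding ZG_units_iff by blast
      have "conv (coef u) (coef x) g = conv (coef x) (coef u) g" if g: "g \<in> carrier G" for g
      proof -
        have "conv (coef u) (coef x) g = (\<Sum>h\<in>carrier G. coef u (g \<otimes> inv h) * coef x h)"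
          unfolding conv_def
          by (rule sum.reindex_bij_witness[of _ "\<lambda>h. g \<otimes> inv h" "\<lambda>h. inv h \<otimes> g"])
            (use g in \<open>auto simp: inv_mult_group m_assoc inv_solve_left' m_assoc[symmetric]\<close>)
        also have "\<dots> = conv (coef x) (coef u) g"
          unfolding conv_def by (intro sum.cong refl) (use g class_fun in simp)
        finally show ?thesis .
      qed
      then have "reg (coef u) * reg (coef x) = reg (coef x) * reg (coef u)"
        unfolding reg_mult by (rule reg_cong)
      then show ?thesis
        by (intro reg_coef_inject[OF ZG_mult_closed[OF uc xc] ZG_mult_closed[OF xc uc]])
          (simp only: reg_coef_mult[OF uc xc] reg_coef_mult[OF xc uc])
    qed
    then show ?L using u by (simp add: group_centre_def units_of_mult)
  }
qed

lemma trivial_central_units: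
  assumes z: "z \<in> group_centre G"
  shows "Poly_Mapping.single z 1 \<in> group_centre (units_of ZG)"
    "- Poly_Mapping.single z 1 \<in> group_centre (units_of ZG)"
proof -
  have zc: "z \<in> carrier G" and comm: "\<And>x. x \<in> carrier G \<Longrightarrow> z \<otimes> x = x \<otimes> z"
    using z by (auto simp: group_centre_def)
  have neg: "reg (coef (- a)) = - reg (coef a)" for a
    by (rule eq_matI) (auto simp: reg_def coef_def)
  have neg_mult: "- reg c * reg d = - (reg c * reg d)" "reg c * - reg d = - (reg c * reg d)" for c d
    by (rule uminus_mult_left_mat uminus_mult_right_mat, simp add: reg_def)+
  have neg_neg: "- (- A) = A" for A :: "complex mat" by (rule eq_matI) auto
  have neg_mult2: "- reg c * - reg d = reg c * reg d" for c d
    by (subst uminus_mult_left_mat) (simp_all add: reg_def neg_mult[unfolded reg_def] neg_neg)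
  have inv: "reg (point (inv z)) * reg (point z) = 1\<^sub>m n" "reg (point z) * reg (point (inv z)) = 1\<^sub>m n"
    using zc by (simp_all add: reg_point_mult reg_point_one)
  have com: "reg (point z) * reg (point g) = reg (point g) * reg (point z)" if "g \<in> carrier G" for g
    using zc that comm by (simp add: reg_point_mult)
  show "Poly_Mapping.single z 1 \<in> group_centre (units_of ZG)"
    unfolding central_unit_iff reg_coef_single
    using zc inv com by (auto intro!: bexI[of _ "Poly_Mapping.single (inv z) 1"] simp: reg_coef_single)
  show "- Poly_Mapping.single z 1 \<in> group_centre (units_of ZG)"
    unfolding central_unit_iff neg reg_coef_single
    using zc inv com by (auto intro!: bexI[of _ "- Poly_Mapping.single (inv z) 1"] simp: reg_coef_single neg neg_mult neg_mult2)
qed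

end

context enumerated_group
begin

section \<open>Triviality of central units under the conjugacy condition\<close>

text \<open>The matrices of the group ring over \<open>R\<close>, used for \<open>R = \<int>\<close> and \<open>R = \<rat>\<close>.\<close>

definition reg_over :: "complex set \<Rightarrow> complex mat \<Rightarrow> bool" where
  "reg_over R A \<longleftrightarrow> (\<exists>c. (\<forall>g\<in>carrier G. c g \<in> R) \<and> A = reg c)"

lemma reg_over_reg: "(\<And>g. g \<in> carrier G \<Longrightarrow> c g \<in> R) \<Longrightarrow> reg_over R (reg c)"
  unfolding reg_over_def by blast

lemma reg_over_carrier: "reg_over R A \<Longrightarrow> A \<in> carrier_mat n n"
  unfolding reg_over_def by auto

lemma reg_over_one: "0 \<in> R \<Longrightarrow> 1 \<in> R \<Longrightarrow> reg_over R (1\<^sub>m n)"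
  unfolding reg_point_one[symmetric] by (rule reg_over_reg) (simp add: point_def)

lemma reg_over_mult:
  assumes R: "0 \<in> R" "\<And>a b. a \<in> R \<Longrightarrow> b \<in> R \<Longrightarrow> a + b \<in> R" "\<And>a b. a \<in> R \<Longrightarrow> b \<in> R \<Longrightarrow> a * b \<in> R"
    and A: "reg_over R A" and B: "reg_over R B"
  shows "reg_over R (A * B)"
proof -
  obtain c d where cd: "\<And>g. g \<in> carrier G \<Longrightarrow> c g \<in> R" "A = reg c" "\<And>g. g \<in> carrier G \<Longrightarrow> d g \<in> R" "B = reg d"
    using A B unfolding reg_over_def by blast
  have sums: "(\<And>h. h \<in> H \<Longrightarrow> f h \<in> R) \<Longrightarrow> sum f H \<in> R" if "finite H" for f :: "'a \<Rightarrow> complex" and H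
    using that by (induction H) (use R in auto)
  show ?thesis unfolding cd(2,4) reg_mult
  proof (rule reg_over_reg)
    fix g assume "g \<in> carrier G"
    then show "conv c d g \<in> R" unfolding conv_def using cd R by (intro sums[OF finite_carrier]) simp
  qed
qed

lemma reg_over_pow:
  assumes R: "0 \<in> R" "1 \<in> R" "\<And>a b. a \<in> R \<Longrightarrow> b \<in> R \<Longrightarrow> a + b \<in> R" "\<And>a b. a \<in> R \<Longrightarrow> b \<in> R \<Longrightarrow> a * b \<in> R"
    and A: "reg_over R A"
  shows "reg_over R (A ^\<^sub>m k)"
proof (induction k)
  case 0
  then show ?case using reg_over_one[OF R(1,2)] carrier_matD(1)[OF reg_over_carrier[OF A]] by simp
next
  case (Suc k)
  then show ?case using reg_over_mult[OF R(1,3,4) _ A] by simp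
qed

lemma reg_over_transpose:
  assumes "reg_over R A" shows "reg_over R (transpose_mat A)"
proof -
  obtain c where c: "\<And>g. g \<in> carrier G \<Longrightarrow> c g \<in> R" "A = reg c" using assms unfolding reg_over_def by blast
  show ?thesis unfolding c(2) reg_transpose by (rule reg_over_reg) (simp add: c(1))
qed

lemma reg_over_linear:
  assumes R: "\<And>a b. a \<in> R \<Longrightarrow> b \<in> R \<Longrightarrow> a + b \<in> R" "\<And>a b. a \<in> R \<Longrightarrow> b \<in> R \<Longrightarrow> a * b \<in> R"
    and "reg_over R A" "reg_over R B" "a \<in> R" "b \<in> R"
  shows "reg_over R (a \<cdot>\<^sub>m A + b \<cdot>\<^sub>m B)"
proof -
  obtain c d where cd: "\<And>g. g \<in> carrier G \<Longrightarrow> c g \<in> R" "A = reg c" "\<And>g. g \<in> carrier G \<Longrightarrow> d g \<in> R" "B = reg d"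
    using assms(3,4) unfolding reg_over_def by blast
  show ?thesis unfolding cd(2,4) reg_linear by (rule reg_over_reg) (use cd R assms(5,6) in simp)
qed

text \<open>The eigenspace of a central element is an invariant subspace, and powers of the element act on it as scalars.\<close>

lemma eigenprojection:
  assumes eb: "eigenbasis P Q n" and A: "A = spectral P Q n d"
    and comm: "\<And>g. g \<in> carrier G \<Longrightarrow> reg (point g) * A = A * reg (point g)"
  shows "invariant_projection (spectral P Q n (\<lambda>j. if d j = l then 1 else 0))" (is "invariant_projection ?e")
    and "trace_mat (A ^\<^sub>m k * spectral P Q n (\<lambda>j. if d j = l then 1 else 0)) = l ^ k * of_nat (card {j. j < n \<and> d j = l})"
proof -
  interpret eb: eigenbasis P Q n by (rule eb)
  show "invariant_projection ?e"
    unfolding invariant_projection_def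
  proof (intro conjI ballI)
    show "?e * ?e = ?e" unfolding eb.spectral_mult by (rule eb.spectral_cong) simp
    fix g assume g: "g \<in> carrier G"
    show "reg (point g) * ?e = ?e * reg (point g)"
      by (rule eb.spectral_commute[of _ d]) (use comm[OF g] in \<open>simp_all add: A\<close>)
  qed simp
  have "trace_mat (A ^\<^sub>m k * ?e) = (\<Sum>j<n. d j ^ k * (if d j = l then 1 else 0))"
    unfolding A eb.spectral_pow eb.spectral_mult eb.trace_spectral ..
  also have "\<dots> = (\<Sum>j\<in>{j. j < n \<and> d j = l}. l ^ k)"
    by (rule sum.mono_neutral_cong_right) auto
  finally show "trace_mat (A ^\<^sub>m k * ?e) = l ^ k * of_nat (card {j. j < n \<and> d j = l})" by simp
qed

lemma character_conjugate_in:
  assumes "invariant_projection e" "conjugate_in G x y" "x \<in> carrier G"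
  shows "character e y = character e x"
  using assms character_conjugate unfolding conjugate_in_def by metis

lemma character_real_conjugate:
  assumes e: "invariant_projection e" and r: "real_conjugate y x" and x: "x \<in> carrier G" and y: "y \<in> carrier G"
  shows "character e y + character e (inv y) = character e x + character e (inv x)"
  using r unfolding real_conjugate_def
proof
  assume c: "conjugate_in G y x"
  then show ?thesis using character_conjugate_in[OF e c y] character_conjugate_in[OF e conjugate_in_inv[OF c y]] y by simp
next
  assume c: "conjugate_in G y (inv x)"
  then show ?thesis using character_conjugate_in[OF e c y] character_conjugate_in[OF e conjugate_in_inv[OF c y]] x y by simp
qed

text \<open>By hypothesis \<open>\<chi>(g) + \<chi>(g\<^sup>-\<^sup>1)\<close> does not change when \<open>g\<close> is replaced by an odd power, so it equals
  its average over the \<open>2\<^bsup>m-1\<^esup>\<close> odd powers, and the sums of odd powers of roots of unity are divisible by \<open>2\<^bsup>m-1\<^esup>\<close>.\<close>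

lemma character_plus_inverse_integral:
  assumes e: "invariant_projection e" and g: "g \<in> carrier G" and o: "g [^] ((2::nat) ^ m) = \<one>" and m: "m \<ge> 1"
    and r: "\<And>j. odd j \<Longrightarrow> real_conjugate (g [^] (j::nat)) g"
  shows "character e g + character e (inv g) \<in> \<int>"
proof -
  define w :: "nat \<Rightarrow> complex" where "w j = (if odd j then 1 else 0)" for j
  have s: "\<exists>z::int. (\<Sum>j<2 ^ m. w j * b ^ j) = of_int z * 2 ^ (m - 1)" if b: "b = 0 \<or> b ^ 2 ^ m = 1" for b
  proof -
    obtain z :: int where "(\<Sum>j<2 ^ m. if odd j then b ^ j else 0) = of_int (2 ^ (m - 1) * z)"
      using sum_odd_powers_root_of_unity[OF b m] by blast
    moreover have "(\<Sum>j<2 ^ m. w j * b ^ j) = (\<Sum>j<2 ^ m. if odd j then b ^ j else 0)"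
      by (intro sum.cong) (auto simp: w_def)
    ultimately show ?thesis by (intro exI[of _ z]) simp
  qed
  have w0: "w 0 = 0" by (simp add: w_def)
  obtain z1 :: int where z1: "(\<Sum>j<2 ^ m. w j * character e (g [^] j)) = of_int z1 * 2 ^ (m - 1)"
    using character_weighted_sum[OF e g o w0 s] by blast
  have "(inv g) [^] ((2::nat) ^ m) = \<one>" using g o by (simp add: nat_pow_inv)
  from character_weighted_sum[OF e inv_closed[OF g] this w0 s] obtain z2 :: int
    where z2: "(\<Sum>j<2 ^ m. w j * character e (inv g [^] j)) = of_int z2 * 2 ^ (m - 1)" by blast
  have "of_int (z1 + z2) * 2 ^ (m - 1) = (\<Sum>j<2 ^ m. w j * (character e (g [^] j) + character e (inv g [^] j)))"
    using z1 z2 by (simp add: distrib_left distrib_right sum.distrib)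
  also have "\<dots> = (\<Sum>j<2 ^ m. w j * (character e g + character e (inv g)))"
  proof (intro sum.cong refl)
    fix j :: nat
    have "character e (g [^] j) + character e (inv g [^] j) = character e g + character e (inv g)" if "odd j"
      using character_real_conjugate[OF e r[OF that] g] g by (simp add: nat_pow_inv)
    then show "w j * (character e (g [^] j) + character e (inv g [^] j)) = w j * (character e g + character e (inv g))"
      by (simp add: w_def)
  qed
  also have "\<dots> = (\<Sum>j<2 ^ m. w j) * (character e g + character e (inv g))"
    by (rule sum_distrib_right[symmetric])
  also have "(\<Sum>j<2 ^ m. w j) = 2 ^ (m - 1)"
  proof -
    have "(\<Sum>j<2 ^ m. w j) = (\<Sum>j<2 * 2 ^ (m - 1). w j)" using m by (cases m) simp_all
    also have "\<dots> = (\<Sum>k<2 ^ (m - 1). \<Sum>r<2. w (2 * k + r))" by (rule sum_blocks)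
    also have "\<dots> = (\<Sum>k<(2::nat) ^ (m - 1). 1)"
    proof (intro sum.cong refl)
      fix k
      have "(\<Sum>r<2. F r) = F 0 + F 1" for F :: "nat \<Rightarrow> complex"
        by (simp add: lessThan_nat_numeral lessThan_Suc)
      then show "(\<Sum>r<2. w (2 * k + r)) = 1" by (simp add: w_def)
    qed
    finally show ?thesis by simp
  qed
  finally have "character e g + character e (inv g) = of_int (z1 + z2)" by simp
  then show ?thesis by (simp only: Ints_of_int)
qed

text \<open>Symmetry of the coefficients pairs each \<open>\<chi>(g)\<close> with \<open>\<chi>(g\<^sup>-\<^sup>1)\<close>; counting every pair twice costs the factor 2.\<close>

lemma twice_trace_integral:
  assumes e: "invariant_projection e" and m: "m \<ge> 1" and o: "\<And>g. g \<in> carrier G \<Longrightarrow> g [^] ((2::nat) ^ m) = \<one>"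
    and r: "\<And>g j. g \<in> carrier G \<Longrightarrow> odd j \<Longrightarrow> real_conjugate (g [^] (j::nat)) g"
    and A: "reg_over \<int> A" and sym: "transpose_mat A = A"
  shows "2 * trace_mat (A * e) \<in> \<int>"
proof -
  obtain c where c: "\<And>g. g \<in> carrier G \<Longrightarrow> c g \<in> \<int>" "A = reg c" using A unfolding reg_over_def by blast
  have cinv: "c (inv g) = c g" if "g \<in> carrier G" for g
    using sym that reg_inject unfolding c(2) reg_transpose by metis
  have ec: "e \<in> carrier_mat n n" using e by (simp add: invariant_projection_def)
  have tr: "trace_mat (A * e) = (\<Sum>g\<in>carrier G. c g * character e g)"
    unfolding c(2) character_def by (rule trace_reg_mult[OF ec])
  also have "\<dots> = (\<Sum>g\<in>carrier G. c g * character e (inv g))"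
    by (rule sum.reindex_bij_witness[of _ "\<lambda>g. inv g" "\<lambda>g. inv g"]) (auto simp: cinv)
  finally have "2 * trace_mat (A * e) = (\<Sum>g\<in>carrier G. c g * (character e g + character e (inv g)))"
    using tr by (simp add: distrib_left sum.distrib)
  also have "\<dots> \<in> \<int>"
    by (intro Ints_sum Ints_mult c character_plus_inverse_integral[OF e _ o m r])
  finally show ?thesis .
qed

text \<open>On the eigenspace of \<open>l\<close>, of dimension \<open>N\<close>, the traces of \<open>V\<^sup>k\<close> and of the powers of the inverse are \<open>N l\<^sup>k\<close> and
  \<open>N l\<^sup>-\<^sup>k\<close>. Their doubles are integers, which forces \<open>|l| = 1\<close>.\<close>

lemma eigenvalue_norm_one:
  assumes eb: "eigenbasis P Q n" and V: "V = spectral P Q n d" and V': "V' \<in> carrier_mat n n" "V' * V = 1\<^sub>m n"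
    and comm: "\<And>g. g \<in> carrier G \<Longrightarrow> reg (point g) * V = V * reg (point g)"
    and int: "\<And>e k. invariant_projection e \<Longrightarrow> 2 * trace_mat (V ^\<^sub>m k * e) \<in> \<int>"
      "\<And>e k. invariant_projection e \<Longrightarrow> 2 * trace_mat (V' ^\<^sub>m k * e) \<in> \<int>"
    and i: "i < n"
  shows "norm (d i) = 1"
proof -
  interpret eb: eigenbasis P Q n by (rule eb)
  have Vc: "V \<in> carrier_mat n n" by (simp add: V)
  have V'e: "V' * (V * M) = M" if "M \<in> carrier_mat n n" for M
    using that V' Vc by (simp flip: assoc)
  have d0: "d j \<noteq> 0" if j: "j < n" for j
  proof
    assume dj: "d j = 0"
    let ?f = "\<lambda>k. if k = j then 1 else 0 :: complex"
    have "V * spectral P Q n ?f = spectral P Q n (\<lambda>k. 0 * 1 + 0 * 1)"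
      unfolding V eb.spectral_mult using dj by (intro eb.spectral_cong) auto
    also have "\<dots> = V * spectral P Q n (\<lambda>_. 0)"
      unfolding V eb.spectral_mult by (intro eb.spectral_cong) auto
    finally have "spectral P Q n ?f = spectral P Q n (\<lambda>_. 0)" using V'e eb.spectral_carrier by metis
    from eb.spectral_inject[OF this j] show False by simp
  qed
  have "V * spectral P Q n (\<lambda>j. inverse (d j)) = spectral P Q n (\<lambda>_. 1)"
    unfolding V eb.spectral_mult using d0 by (intro eb.spectral_cong) simp
  then have "V' * 1\<^sub>m n = spectral P Q n (\<lambda>j. inverse (d j))"
    using V'e[OF eb.spectral_carrier, of "\<lambda>j. inverse (d j)"] by (simp add: eb.spectral_one)
  then have V's: "V' = spectral P Q n (\<lambda>j. inverse (d j))" using V' by simp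
  have comm': "reg (point g) * V' = V' * reg (point g)" if "g \<in> carrier G" for g
    unfolding V's by (rule eb.spectral_commute[of _ d]) (use comm[OF that] in \<open>simp_all add: V\<close>)
  define N where "N = card {j. j < n \<and> d j = d i}"
  have fin: "finite {j. j < n \<and> d j = d i}" by simp
  have N: "N > 0" unfolding N_def using i fin by (auto simp: card_gt_0_iff)
  let ?e = "spectral P Q n (\<lambda>j. if d j = d i then 1 else 0)"
  have e': "?e = spectral P Q n (\<lambda>j. if inverse (d j) = inverse (d i) then 1 else 0)" by simp
  have e: "invariant_projection ?e" by (rule eigenprojection(1)[OF eb V comm])
  show ?thesis
  proof (rule norm_one_of_integral_multiples)
    show "2 * of_nat N \<noteq> (0::complex)" using N by simp
    show "d i \<noteq> 0" by (rule d0[OF i])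
    fix k
    have "trace_mat (V ^\<^sub>m k * ?e) = d i ^ k * of_nat N"
      unfolding N_def by (rule eigenprojection(2)[OF eb V comm])
    then show "2 * of_nat N * d i ^ k \<in> \<int>" using int(1)[OF e, of k] by (simp add: mult_ac)
    have "trace_mat (V' ^\<^sub>m k * ?e) = inverse (d i) ^ k * of_nat N"
      using eigenprojection(2)[OF eb V's comm', of k "inverse (d i)"] unfolding N_def by simp
    then show "2 * of_nat N * inverse (d i) ^ k \<in> \<int>" using int(2)[OF e, of k] by (simp add: mult_ac)
  qed
qed

text \<open>The eigenvalues of \<open>v = u u\<^sup>*\<close> have absolute value 1, so the trace \<open>|G| v(1)\<close> is at most \<open>|G|\<close>,
  while \<open>v(1)\<close> is the sum of the squares of the integer coefficients of \<open>u\<close>.\<close>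

lemma central_unit_trivial:
  assumes m: "m \<ge> 1" and o: "\<And>g. g \<in> carrier G \<Longrightarrow> g [^] ((2::nat) ^ m) = \<one>"
    and r: "\<And>g j. g \<in> carrier G \<Longrightarrow> odd j \<Longrightarrow> real_conjugate (g [^] (j::nat)) g"
    and u: "u \<in> group_centre (units_of ZG)"
  shows "\<exists>z\<in>group_centre G. u = Poly_Mapping.single z 1 \<or> u = - Poly_Mapping.single z 1"
proof -
  obtain w where uc: "u \<in> carrier ZG" and wc: "w \<in> carrier ZG"
    and wu: "reg (coef w) * reg (coef u) = 1\<^sub>m n" "reg (coef u) * reg (coef w) = 1\<^sub>m n"
    and comm: "\<And>g. g \<in> carrier G \<Longrightarrow> reg (coef u) * reg (point g) = reg (point g) * reg (coef u)"
    using u unfolding central_unit_iff by blast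
  define U W where "U = reg (coef u)" and "W = reg (coef w)"
  have UWc [simp]: "U \<in> carrier_mat n n" "W \<in> carrier_mat n n" by (simp_all add: U_def W_def)
  have WU: "W * U = 1\<^sub>m n" "U * W = 1\<^sub>m n" using wu by (simp_all add: U_def W_def)
  let ?T = "transpose_mat"
  have Tc [simp]: "?T U \<in> carrier_mat n n" "?T W \<in> carrier_mat n n" by (simp_all add: transpose_carrier_mat)
  (* V' is the inverse of V; both are symmetric with integral entries *)
  define V V' where "V = U * ?T U" and "V' = ?T W * W"
  have Vc [simp]: "V \<in> carrier_mat n n" "V' \<in> carrier_mat n n" by (simp_all add: V_def V'_def)
  have intU: "reg_over \<int> U" "reg_over \<int> W"
    unfolding U_def W_def by (rule reg_over_reg, simp add: coef_def)+
  have intV: "reg_over \<int> V" "reg_over \<int> V'"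
    unfolding V_def V'_def by (rule reg_over_mult; use intU in \<open>auto intro: reg_over_transpose\<close>)+
  have symV: "?T V = V" "?T V' = V'"
    unfolding V_def V'_def by (simp_all add: transpose_mult[of _ n n _ n])
  have "?T U * ?T W = 1\<^sub>m n" using WU(1) transpose_mult[of W n n U n] by simp
  moreover have "V' * V = ?T W * ((W * U) * ?T U)" unfolding V_def V'_def by (simp add: assoc)
  moreover have "?T W * ?T U = 1\<^sub>m n" using WU(2) transpose_mult[of U n n W n] by simp
  ultimately have V'V: "V' * V = 1\<^sub>m n" unfolding WU by simp
  have commU: "reg (point g) * U = U * reg (point g)" if "g \<in> carrier G" for g
    using comm[OF that] by (simp add: U_def)
  have commT: "reg (point g) * ?T U = ?T U * reg (point g)" if g: "g \<in> carrier G" for g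
  proof -
    have t: "?T (reg (point (inv g))) = reg (point g)"
      unfolding reg_transpose by (rule reg_cong) (use g in \<open>auto simp: point_def\<close>)
    have "?T (U * reg (point (inv g))) = ?T (reg (point (inv g)) * U)" using commU[of "inv g"] g by simp
    then show ?thesis
      unfolding transpose_mult[OF UWc(1) reg_carrier] transpose_mult[OF reg_carrier UWc(1)] t .
  qed
  have commV: "reg (point g) * V = V * reg (point g)" if g: "g \<in> carrier G" for g
  proof -
    have "reg (point g) * V = (reg (point g) * U) * ?T U" unfolding V_def by (simp add: assoc)
    also have "\<dots> = U * (reg (point g) * ?T U)" unfolding commU[OF g] by (simp add: assoc)
    also have "\<dots> = V * reg (point g)" unfolding commT[OF g] V_def by (simp add: assoc)
    finally show ?thesis .
  qed
  obtain v where v: "\<And>g. g \<in> carrier G \<Longrightarrow> v g \<in> \<int>" "V = reg v" using intV(1) unfolding reg_over_def by blast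
  have "hermitian_mat V" unfolding v(2)
  proof (rule hermitian_reg)
    fix g assume g: "g \<in> carrier G"
    have "v (inv g) = v g" using symV(1) g reg_inject unfolding v(2) reg_transpose by metis
    moreover have "cnj (v g) = v g" using v(1)[OF g] by (auto elim: Ints_cases)
    ultimately show "v (inv g) = cnj (v g)" by simp
  qed
  then obtain P Q d where eb: "eigenbasis P Q n" and V: "V = spectral P Q n d"
    using hermitian_eigenbasis[OF Vc(1)] by blast
  have tr_int: "2 * trace_mat (A ^\<^sub>m k * e) \<in> \<int>"
    if "reg_over \<int> A" "?T A = A" "A \<in> carrier_mat n n" "invariant_projection e" for A k e
    by (rule twice_trace_integral[OF that(4) m o r reg_over_pow[OF _ _ _ _ that(1)] transpose_pow[OF that(3,2)]]) auto
  have "norm (d i) = 1" if "i < n" for i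
    by (rule eigenvalue_norm_one[OF eb V Vc(2) V'V commV tr_int[OF intV(1) symV(1) Vc(1)] tr_int[OF intV(2) symV(2) Vc(2)] that])
  then have "norm (\<Sum>i<n. d i) \<le> of_nat n"
    using norm_sum[of d "{..<n}"] by simp
  moreover have "(\<Sum>i<n. d i) = of_nat n * v \<one>"
    using eigenbasis.trace_spectral[OF eb, of d] trace_reg[of v] V v(2) by simp
  ultimately have "norm (v \<one>) \<le> 1" using order_eq(2) by (simp add: norm_mult)
  have "reg v = reg (conv (coef u) (\<lambda>g. coef u (inv g)))"
    unfolding v(2)[symmetric] V_def U_def reg_transpose reg_mult ..
  from reg_inject[OF this one_closed] have "v \<one> = (\<Sum>h\<in>carrier G. coef u h * coef u h)"
    unfolding conv_def by simp
  also have "\<dots> = of_int (\<Sum>h\<in>carrier G. (Poly_Mapping.lookup u h)\<^sup>2)"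
    by (simp add: coef_def power2_eq_square)
  finally have le: "(\<Sum>h\<in>carrier G. (Poly_Mapping.lookup u h)\<^sup>2) \<le> 1"
    using \<open>norm (v \<one>) \<le> 1\<close> by (simp only: norm_of_int)
  have "\<exists>g0\<in>carrier G. Poly_Mapping.lookup u g0 \<noteq> 0"
  proof (rule ccontr)
    assume "\<not> ?thesis"
    then have "reg (coef u) = reg (\<lambda>g. 0)" by (intro reg_cong) (simp add: coef_def)
    moreover have "conv (\<lambda>g. 0) (coef w) = (\<lambda>g. 0)" by (rule ext) (simp add: conv_def)
    ultimately have "reg (point \<one>) = reg (\<lambda>g. 0)"
      using wu(2) reg_mult[of "\<lambda>g. 0" "coef w"] unfolding reg_point_one by simp
    from reg_inject[OF this one_closed] show False by (simp add: point_def)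
  qed
  then obtain z where z: "z \<in> carrier G" "Poly_Mapping.lookup u z \<noteq> 0" by blast
  note tr = single_support_of_square_sum_le_one[OF finite_carrier le z]
  have zero: "Poly_Mapping.lookup u g = 0" if "g \<noteq> z" for g
  proof (cases "g \<in> carrier G")
    case False
    then have "g \<notin> Poly_Mapping.keys u" using uc by auto
    then show ?thesis by (simp add: in_keys_iff)
  qed (use tr(2) that in blast)
  have usingle: "u = Poly_Mapping.single z (Poly_Mapping.lookup u z)"
    by (rule poly_mapping_eqI) (use zero in \<open>auto simp: lookup_single when_def\<close>)
  then have u12: "u = Poly_Mapping.single z 1 \<or> u = - Poly_Mapping.single z 1"
    using tr(1) by (metis single_uminus)
  have "z \<otimes> x = x \<otimes> z" if x: "x \<in> carrier G" for x
  proof -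
    have "reg (conv (coef u) (point x)) = reg (conv (point x) (coef u))"
      using comm[OF x] unfolding reg_mult .
    from reg_inject[OF this, of "z \<otimes> x"] have "coef u (z \<otimes> x \<otimes> inv x) = coef u (inv x \<otimes> (z \<otimes> x))"
      using z(1) x by (simp add: conv_point_left conv_point_right)
    moreover have "z \<otimes> x \<otimes> inv x = z" using z(1) x by (simp add: m_assoc)
    ultimately have "coef u (inv x \<otimes> (z \<otimes> x)) \<noteq> 0" using z(2) by (simp add: coef_def)
    then have "inv x \<otimes> (z \<otimes> x) = z" using zero unfolding coef_def by (metis of_int_0)
    then show ?thesis using z(1) x by (metis inv_cancel(2) m_closed)
  qed
  then have "z \<in> group_centre G" using z(1) by (simp add: group_centre_def)
  then show ?thesis using u12 by blast
qed

theorem cut_of_real_conjugate: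
  assumes m: "m \<ge> 1" and o: "\<And>g. g \<in> carrier G \<Longrightarrow> g [^] ((2::nat) ^ m) = \<one>"
    and r: "\<And>g. g \<in> carrier G \<Longrightarrow> real_conjugate (g [^] (3::nat)) g"
  shows "cut_property G"
proof -
  have r': "real_conjugate (g [^] (j::nat)) g" if "g \<in> carrier G" "odd j" for g j
    by (rule real_conjugate_odd_power[OF that(1) o[OF that(1)] _ r[OF that(1)] that(2)]) simp
  show ?thesis
    unfolding cut_property_def
    using trivial_central_units central_unit_trivial[OF m o r'] by blast
qed

section \<open>A nontrivial central unit from a missing conjugacy\<close>

text \<open>The sum of \<open>\<theta>(j) h x\<^sup>j h\<^sup>-\<^sup>1\<close> over all \<open>h\<close> and \<open>j\<close>, symmetrised under inversion. The sum over \<open>h\<close> makes it central,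
  the symmetrisation makes its matrix Hermitian.\<close>

definition theta_element :: "nat \<Rightarrow> 'a \<Rightarrow> 'a \<Rightarrow> complex" where
  "theta_element m x g = (\<Sum>h\<in>carrier G. \<Sum>j<2 ^ m.
    theta j * (point (h \<otimes> x [^] j \<otimes> inv h) g + point (h \<otimes> x [^] j \<otimes> inv h) (inv g)))"

lemma theta_element_inv:
  "g \<in> carrier G \<Longrightarrow> theta_element m x (inv g) = theta_element m x g"
  by (simp add: theta_element_def add.commute)

lemma theta_element_integral: "theta_element m x g \<in> \<int>"
proof -
  have "theta j \<in> \<int>" for j using theta_cases[of j] by auto
  then show ?thesis unfolding theta_element_def point_def by (intro Ints_sum Ints_mult Ints_add) auto
qed

lemma theta_element_conjugate:
  assumes x: "x \<in> carrier G" and g: "g \<in> carrier G" and k: "k \<in> carrier G"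
  shows "theta_element m x (k \<otimes> g \<otimes> inv k) = theta_element m x g"
proof -
  have shift: "point (h \<otimes> y \<otimes> inv h) (k \<otimes> f \<otimes> inv k) = point ((inv k \<otimes> h) \<otimes> y \<otimes> inv (inv k \<otimes> h)) f"
    if "h \<in> carrier G" "y \<in> carrier G" "f \<in> carrier G" for h y f
  proof -
    have "k \<otimes> f \<otimes> inv k = h \<otimes> y \<otimes> inv h \<longleftrightarrow> f = (inv k \<otimes> h) \<otimes> y \<otimes> inv (inv k \<otimes> h)"
    proof
      assume eq: "k \<otimes> f \<otimes> inv k = h \<otimes> y \<otimes> inv h"
      have "f = inv k \<otimes> (k \<otimes> f \<otimes> inv k) \<otimes> k" using that k by (simp add: m_assoc inv_cancel)
      then show "f = (inv k \<otimes> h) \<otimes> y \<otimes> inv (inv k \<otimes> h)"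
        unfolding eq using that k by (simp add: m_assoc inv_mult_group)
    next
      assume "f = (inv k \<otimes> h) \<otimes> y \<otimes> inv (inv k \<otimes> h)"
      then show "k \<otimes> f \<otimes> inv k = h \<otimes> y \<otimes> inv h"
        using that k by (simp add: m_assoc inv_mult_group inv_cancel)
    qed
    then show ?thesis by (simp add: point_def)
  qed
  have inv: "inv (k \<otimes> g \<otimes> inv k) = k \<otimes> inv g \<otimes> inv k" using g k by (simp add: m_assoc inv_mult_group)
  define F where "F h = (\<Sum>j<2 ^ m. theta j * (point (h \<otimes> x [^] j \<otimes> inv h) g + point (h \<otimes> x [^] j \<otimes> inv h) (inv g)))" for h
  have "theta_element m x (k \<otimes> g \<otimes> inv k) = (\<Sum>h\<in>carrier G. F (inv k \<otimes> h))"
    unfolding theta_element_def F_def inv by (intro sum.cong refl) (use x g in \<open>simp add: shift\<close>)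
  also have "\<dots> = (\<Sum>h\<in>carrier G. F h)"
    by (rule sum.reindex_bij_witness[of _ "\<lambda>h. k \<otimes> h" "\<lambda>h. inv k \<otimes> h"]) (use k in \<open>auto simp: inv_cancel\<close>)
  finally show ?thesis unfolding F_def theta_element_def .
qed

text \<open>The coefficient at \<open>x\<close> is a sum of values \<open>\<theta>(j)\<close> over exponents with \<open>x\<^sup>j\<close> conjugate to \<open>x\<close> or its inverse. By
  hypothesis none of these values is negative, and \<open>j = 1\<close> contributes 1.\<close>

lemma theta_element_nonzero:
  assumes m: "m \<ge> 1" and x: "x \<in> carrier G"
    and nr: "\<And>j. j mod 8 = 3 \<or> j mod 8 = 5 \<Longrightarrow> \<not> real_conjugate (x [^] (j::nat)) x"
  shows "theta_element m x x \<noteq> 0"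
proof -
  define F where "F h j = Re (theta j * (point (h \<otimes> x [^] j \<otimes> inv h) x + point (h \<otimes> x [^] j \<otimes> inv h) (inv x)))" for h j
  have nn: "F h j \<ge> 0" if h: "h \<in> carrier G" for h and j :: nat
  proof (cases "j mod 8 = 3 \<or> j mod 8 = 5")
    case True
    have "h \<otimes> x [^] j \<otimes> inv h \<noteq> x" "h \<otimes> x [^] j \<otimes> inv h \<noteq> inv x"
      using nr[OF True] h unfolding real_conjugate_def conjugate_in_def by metis+
    then show ?thesis by (simp add: F_def point_def)
  next
    case False
    then have "theta j = 0 \<or> theta j = 1" by (simp add: theta_def)
    then show ?thesis by (auto simp: F_def point_def)
  qed
  have th1: "theta 1 = 1" by (simp add: theta_def)
  have F1: "1 \<le> F \<one> 1"
    unfolding F_def th1 using x by (simp add: point_def)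
  have "Re (theta_element m x x) = (\<Sum>h\<in>carrier G. \<Sum>j<2 ^ m. F h j)"
    unfolding theta_element_def F_def by simp
  also have "\<dots> \<ge> (\<Sum>j<2 ^ m. F \<one> j)"
    by (rule member_le_sum) (auto intro!: sum_nonneg nn simp: finite_carrier)
  moreover have "(\<Sum>j<2 ^ m. F \<one> j) \<ge> F \<one> 1"
    by (rule member_le_sum) (use one_less_power[of "2::nat" m] m nn in auto)
  ultimately have "1 \<le> Re (theta_element m x x)" using F1 by linarith
  then show ?thesis by auto
qed

text \<open>Characters are constant on conjugates, so the trace is \<open>|G|\<close> times the \<open>\<theta>\<close>-weighted sums of the character
  along the powers of \<open>x\<close> and of its inverse.\<close>

lemma trace_theta_element:
  assumes e: "invariant_projection e" and m: "m \<ge> 3" and x: "x \<in> carrier G" and o: "x [^] ((2::nat) ^ m) = \<one>"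
  shows "\<exists>z::int. trace_mat (reg (theta_element m x) * e) = of_int z * of_real (sqrt 2)"
proof -
  have ec: "e \<in> carrier_mat n n" using e by (simp add: invariant_projection_def)
  have pt: "(\<Sum>g\<in>carrier G. point y g * character e g) = character e y"
    "(\<Sum>g\<in>carrier G. point y (inv g) * character e g) = character e (inv y)" if y: "y \<in> carrier G" for y
  proof -
    have "(\<Sum>g\<in>carrier G. point y g * character e g) = (\<Sum>g\<in>carrier G. if g = y then character e y else 0)"
      by (intro sum.cong) (auto simp: point_def)
    then show "(\<Sum>g\<in>carrier G. point y g * character e g) = character e y" using y finite_carrier by simp
    have "(\<Sum>g\<in>carrier G. point y (inv g) * character e g) = (\<Sum>g\<in>carrier G. if g = inv y then character e (inv y) else 0)"
      by (intro sum.cong) (use y in \<open>auto simp: point_def\<close>)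
    then show "(\<Sum>g\<in>carrier G. point y (inv g) * character e g) = character e (inv y)" using y finite_carrier by simp
  qed
  have th0: "theta 0 = 0" by (simp add: theta_def)
  have s: "\<exists>z::int. (\<Sum>j<2 ^ m. theta j * b ^ j) = of_int z * of_real (sqrt 2)" if b: "b = 0 \<or> b ^ 2 ^ m = 1" for b
    by (rule sum_theta_powers_root_of_unity[OF b m])
  obtain z1 :: int where z1: "(\<Sum>j<2 ^ m. theta j * character e (x [^] j)) = of_int z1 * of_real (sqrt 2)"
    using character_weighted_sum[OF e x o th0 s] by blast
  have "(inv x) [^] ((2::nat) ^ m) = \<one>" using x o by (simp add: nat_pow_inv)
  from character_weighted_sum[OF e inv_closed[OF x] this th0 s] obtain z2 :: int
    where z2: "(\<Sum>j<2 ^ m. theta j * character e (inv x [^] j)) = of_int z2 * of_real (sqrt 2)" by blast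
  have "trace_mat (reg (theta_element m x) * e) = (\<Sum>g\<in>carrier G. theta_element m x g * character e g)"
    unfolding character_def by (rule trace_reg_mult[OF ec])
  also have "\<dots> = (\<Sum>g\<in>carrier G. \<Sum>h\<in>carrier G. \<Sum>j<2 ^ m. theta j * (point (h \<otimes> x [^] j \<otimes> inv h) g * character e g
        + point (h \<otimes> x [^] j \<otimes> inv h) (inv g) * character e g))"
    unfolding theta_element_def sum_distrib_right by (intro sum.cong refl) (simp add: algebra_simps)
  also have "\<dots> = (\<Sum>h\<in>carrier G. \<Sum>j<2 ^ m. \<Sum>g\<in>carrier G. theta j * (point (h \<otimes> x [^] j \<otimes> inv h) g * character e g
        + point (h \<otimes> x [^] j \<otimes> inv h) (inv g) * character e g))"
    by (subst sum.swap, intro sum.cong refl, subst sum.swap, rule refl)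
  also have "\<dots> = (\<Sum>h\<in>carrier G. \<Sum>j<2 ^ m. theta j * (character e (x [^] j) + character e (inv x [^] j)))"
  proof (intro sum.cong refl)
    fix h and j :: nat assume h: "h \<in> carrier G"
    let ?y = "h \<otimes> x [^] j \<otimes> inv h"
    have y: "?y \<in> carrier G" using h x by simp
    have "inv ?y = h \<otimes> inv x [^] j \<otimes> inv h" using h x by (simp add: inv_mult_group m_assoc nat_pow_inv)
    then have ch: "character e ?y = character e (x [^] j)" "character e (inv ?y) = character e (inv x [^] j)"
      using character_conjugate[OF e _ h] x by simp_all
    have "(\<Sum>g\<in>carrier G. theta j * (point ?y g * character e g + point ?y (inv g) * character e g))
      = theta j * ((\<Sum>g\<in>carrier G. point ?y g * character e g) + (\<Sum>g\<in>carrier G. point ?y (inv g) * character e g))"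
      by (simp only: sum_distrib_left[symmetric] sum.distrib)
    then show "(\<Sum>g\<in>carrier G. theta j * (point ?y g * character e g + point ?y (inv g) * character e g))
      = theta j * (character e (x [^] j) + character e (inv x [^] j))"
      unfolding pt[OF y] ch .
  qed
  also have "\<dots> = of_int (int n * (z1 + z2)) * of_real (sqrt 2)"
    using z1 z2 order_eq(1) by (simp add: Coset.order_def distrib_left distrib_right sum.distrib)
  finally show ?thesis by blast
qed

text \<open>An interpolation polynomial \<open>f\<close> with the prescribed rational values at rational points, built up one linear factor at a time and
  applied to \<open>S\<close>. For the set \<open>Y\<close> of the eigenvalues other than \<open>t\<close> this shows that the projection onto the
  eigenspace of \<open>t\<close> is rational.\<close>

lemma rational_spectral_projection:
  fixes \<rho> :: "nat \<Rightarrow> complex"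
  assumes eb: "eigenbasis P Q n" and S: "reg_over \<rat> S" "S = spectral P Q n \<rho>"
    and fin: "finite Y" and Y: "Y \<subseteq> \<rat>" "t \<in> \<rat>" "t \<notin> Y"
  shows "\<exists>f. reg_over \<rat> (spectral P Q n (\<lambda>i. f (\<rho> i))) \<and> f t = 1 \<and> (\<forall>y\<in>Y. f y = 0)"
  using fin Y
proof (induction Y)
  case empty
  have "spectral P Q n (\<lambda>_. 1) = 1\<^sub>m n" by (rule eigenbasis.spectral_one[OF eb])
  then show ?case by (intro exI[of _ "\<lambda>_. 1"]) (simp add: reg_over_one)
next
  case (insert y Y)
  interpret eb: eigenbasis P Q n by (rule eb)
  obtain f where f: "reg_over \<rat> (spectral P Q n (\<lambda>i. f (\<rho> i)))" "f t = 1" "\<And>y. y \<in> Y \<Longrightarrow> f y = 0"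
    using insert by blast
  have ty: "t - y \<noteq> 0" using insert.prems by auto
  have at_t: "(1 / (t - y)) * t + (- y / (t - y)) * 1 = 1"
    using ty by (simp flip: diff_divide_distrib)
  have "reg_over \<rat> ((1 / (t - y)) \<cdot>\<^sub>m S + (- y / (t - y)) \<cdot>\<^sub>m 1\<^sub>m n)"
    by (rule reg_over_linear) (use insert.prems S in \<open>auto intro: reg_over_one\<close>)
  also have "(1 / (t - y)) \<cdot>\<^sub>m S + (- y / (t - y)) \<cdot>\<^sub>m 1\<^sub>m n = spectral P Q n (\<lambda>i. (1 / (t - y)) * \<rho> i + (- y / (t - y)) * 1)"
    unfolding eb.spectral_linear S(2) eb.spectral_one ..
  finally have "reg_over \<rat> (spectral P Q n (\<lambda>i. f (\<rho> i)) * spectral P Q n (\<lambda>i. (1 / (t - y)) * \<rho> i + (- y / (t - y)) * 1))"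
    by (intro reg_over_mult f(1)) auto
  then have "reg_over \<rat> (spectral P Q n (\<lambda>i. f (\<rho> i) * ((1 / (t - y)) * \<rho> i + (- y / (t - y)) * 1)))"
    unfolding eb.spectral_mult .
  then show ?case
    by (intro exI[of _ "\<lambda>r. f r * ((1 / (t - y)) * r + (- y / (t - y)) * 1)"])
      (use f at_t in \<open>auto\<close>)
qed

text \<open>Let \<open>E\<close> project onto the eigenspaces where \<open>S\<close>, the matrix of \<open>s\<close>, is \<open>\<plusminus>\<surd>2 r0\<close>. Then \<open>\<surd>2 \<mapsto> S E / r0\<close> embeds \<open>\<rat>(\<surd>2)\<close> into
  the rational centre with unit \<open>E\<close>, and \<open>1 + (A - 1) E \<plusminus> (B / r0) S E\<close> are mutually inverse when
  \<open>A\<^sup>2 - 2 B\<^sup>2 = 1\<close>. They have integral coefficients if \<open>A - 1\<close> and \<open>B\<close> clear the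
  denominators of \<open>E\<close> and \<open>S E / r0\<close>. The eigenvalue \<open>A + B \<surd>2 > 1\<close> excludes trivial units, which have finite order.\<close>

lemma nontrivial_central_unit:
  assumes m: "m \<ge> 3" and x: "x \<in> carrier G" and o: "\<And>g. g \<in> carrier G \<Longrightarrow> g [^] ((2::nat) ^ m) = \<one>"
    and nr: "\<not> real_conjugate (x [^] (3::nat)) x"
  shows "\<exists>u \<in> group_centre (units_of ZG). \<forall>z\<in>carrier G. u \<noteq> Poly_Mapping.single z 1 \<and> u \<noteq> - Poly_Mapping.single z 1"
proof -
  define s where "s = theta_element m x"
  define S where "S = reg s"
  have nr': "\<not> real_conjugate (x [^] j) x" if "j mod 8 = 3 \<or> j mod 8 = 5" for j :: nat
    using real_conjugate_odd_power[OF x o[OF x] that, of 3] nr by auto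
  have sx: "s x \<noteq> 0" unfolding s_def by (rule theta_element_nonzero[OF _ x nr']) (use m in simp)
  have comm: "reg (point g) * S = S * reg (point g)" if "g \<in> carrier G" for g
    unfolding S_def s_def by (rule reg_class_function_commute[symmetric]) (simp_all add: theta_element_conjugate x that)
  have "hermitian_mat S" unfolding S_def s_def
  proof (rule hermitian_reg)
    fix g assume "g \<in> carrier G"
    moreover have "cnj (theta_element m x g) = theta_element m x g"
      using theta_element_integral[of m x g] by (auto elim: Ints_cases)
    ultimately show "theta_element m x (inv g) = cnj (theta_element m x g)" by (simp add: theta_element_inv)
  qed
  then obtain P Q d where eb: "eigenbasis P Q n" and S: "S = spectral P Q n d"
    using hermitian_eigenbasis[of S n] unfolding S_def by auto
  interpret eb: eigenbasis P Q n by (rule eb)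
  have sq2: "of_real (sqrt 2) * of_real (sqrt 2) = (2 :: complex)"
    by (simp flip: of_real_mult)
  have "\<exists>r. r \<in> \<rat> \<and> d i = of_real (sqrt 2) * r" if i: "i < n" for i
  proof -
    let ?e = "spectral P Q n (\<lambda>j. if d j = d i then 1 else 0)" 
    define N where "N = card {j. j < n \<and> d j = d i}"
    have N: "N > 0" using i by (auto simp: N_def card_gt_0_iff)
    have "trace_mat (S ^\<^sub>m 1 * ?e) = d i ^ 1 * of_nat N" unfolding N_def by (rule eigenprojection(2)[OF eb S comm])
    moreover have "S ^\<^sub>m 1 = S" by (simp add: S_def)
    moreover obtain z :: int where "trace_mat (S * ?e) = of_int z * of_real (sqrt 2)"
      using trace_theta_element[OF eigenprojection(1)[OF eb S comm] m x o[OF x]] unfolding S_def s_def by blast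
    ultimately have "d i = of_real (sqrt 2) * (of_int z / of_nat N)" using N by (simp add: field_simps)
    moreover have "of_int z / of_nat N \<in> (\<rat> :: complex set)" by simp
    ultimately show ?thesis by blast
  qed
  then obtain r where r: "\<And>i. i < n \<Longrightarrow> r i \<in> \<rat>" "\<And>i. i < n \<Longrightarrow> d i = of_real (sqrt 2) * r i" by metis
  have "\<exists>i<n. d i \<noteq> 0"
  proof (rule ccontr)
    assume "\<not> ?thesis"
    have zero: "0 \<cdot>\<^sub>m M + 0 \<cdot>\<^sub>m M = 0\<^sub>m n n" if "M \<in> carrier_mat n n" for M :: "complex mat"
      using that by (intro eq_matI) auto
    from \<open>\<not> (\<exists>i<n. d i \<noteq> 0)\<close> have "S = spectral P Q n (\<lambda>i. 0 * 1 + 0 * 1)" unfolding S by (intro eb.spectral_cong) auto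
    also have "\<dots> = 0 \<cdot>\<^sub>m reg s + 0 \<cdot>\<^sub>m reg s" unfolding eb.spectral_linear zero[OF eb.spectral_carrier] zero[OF reg_carrier] ..
    also have "\<dots> = reg (\<lambda>g. 0 * s g + 0 * s g)" by (rule reg_linear)
    finally have "reg s = reg (\<lambda>g. 0 * s g + 0 * s g)" unfolding S_def .
    from reg_inject[OF this x] show False using sx by simp
  qed
  then obtain i0 where i0: "i0 < n" "d i0 \<noteq> 0" by blast
  define r0 where "r0 = r i0"
  have r0: "r0 \<in> \<rat>" "r0 \<noteq> 0" using r[OF i0(1)] i0(2) by (auto simp: r0_def)
  have Srat: "reg_over \<rat> S"
    unfolding S_def s_def by (rule reg_over_reg) (use theta_element_integral Ints_subset_Rats in blast)
  have SS: "reg_over \<rat> (S * S)" by (rule reg_over_mult[OF _ _ _ Srat Srat]) auto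
  have SSs: "S * S = spectral P Q n (\<lambda>i. d i * d i)" unfolding S eb.spectral_mult ..
  define t where "t = d i0 * d i0"
  have dd: "d i * d i = 2 * (r i * r i)" if "i < n" for i
    unfolding r(2)[OF that] using sq2 by (simp add: mult_ac)
  have ddQ: "d i * d i \<in> \<rat>" if "i < n" for i using dd[OF that] r(1)[OF that] by simp
  have YQ: "(\<lambda>i. d i * d i) ` {..<n} - {t} \<subseteq> \<rat>" using ddQ by auto
  have tQ: "t \<in> \<rat>" unfolding t_def by (rule ddQ[OF i0(1)])
  obtain f where f: "reg_over \<rat> (spectral P Q n (\<lambda>i. f (d i * d i)))" "f t = 1"
    "\<And>y. y \<in> (\<lambda>i. d i * d i) ` {..<n} - {t} \<Longrightarrow> f y = 0"
    using rational_spectral_projection[OF eb SS SSs _ YQ tQ] by blast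
  define h where "h i = f (d i * d i)" for i
  have h: "h i = (if d i * d i = t then 1 else 0)" if "i < n" for i
    using f(2,3) that unfolding h_def by auto
  have "reg_over \<rat> (S * spectral P Q n h)"
    unfolding h_def by (rule reg_over_mult[OF _ _ _ Srat f(1)]) auto
  then obtain tc where tc: "\<And>g. g \<in> carrier G \<Longrightarrow> tc g \<in> \<rat>" "S * spectral P Q n h = reg tc"
    unfolding reg_over_def by blast
  have "reg_over \<rat> (spectral P Q n h)" unfolding h_def by (rule f(1))
  then obtain ec where ec: "\<And>g. g \<in> carrier G \<Longrightarrow> ec g \<in> \<rat>" "spectral P Q n h = reg ec"
    unfolding reg_over_def by blast
  have "\<exists>N::int. N > 0 \<and> (\<forall>g\<in>carrier G. of_int N * ec g \<in> \<int>)"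
    by (rule common_denominator[OF finite_carrier ec(1)])
  then obtain N1 :: int where N1: "N1 > 0" "\<And>g. g \<in> carrier G \<Longrightarrow> of_int N1 * ec g \<in> \<int>"
    by (elim exE conjE) blast
  have "\<exists>N::int. N > 0 \<and> (\<forall>g\<in>carrier G. of_int N * (tc g / r0) \<in> \<int>)"
    by (rule common_denominator[OF finite_carrier Rats_divide[OF tc(1) r0(1)]])
  then obtain N2 :: int where N2: "N2 > 0" "\<And>g. g \<in> carrier G \<Longrightarrow> of_int N2 * (tc g / r0) \<in> \<int>"
    by (elim exE conjE) blast
  obtain a b :: int where ab: "a\<^sup>2 - 2 * b\<^sup>2 = 1" "N1 * N2 dvd b" "b > 0"
    using pell_solution_divisible[of "N1 * N2"] N1(1) N2(1) by auto
  (* (a + b \<surd>2)^2, for which A - 1 is divisible by b as well as B *)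
  define A B where "A = 1 + 4 * b\<^sup>2" and "B = 2 * a * b"
  have AB: "A\<^sup>2 - 2 * B\<^sup>2 = 1"
  proof -
    have a2: "a\<^sup>2 = 1 + 2 * b\<^sup>2" using ab(1) by simp
    have "A\<^sup>2 - 2 * B\<^sup>2 = A\<^sup>2 - 8 * a\<^sup>2 * b\<^sup>2" by (simp add: B_def power_mult_distrib)
    also have "\<dots> = 1" unfolding a2 A_def by (simp add: power2_eq_square algebra_simps)
    finally show ?thesis .
  qed
  have "N1 dvd b" "N2 dvd b" using ab(2) by (auto elim: dvdE)
  then have NA: "N1 dvd A - 1" and NB: "N2 dvd B" by (simp_all add: A_def B_def power2_eq_square)
  have intA: "of_int (A - 1) * ec g \<in> \<int>" if "g \<in> carrier G" for g
  proof -
    obtain q where "A - 1 = N1 * q" using NA unfolding dvd_def by blast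
    then have "of_int (A - 1) * ec g = of_int q * (of_int N1 * ec g)" by simp
    then show ?thesis using N1(2)[OF that] by (simp only: Ints_mult Ints_of_int)
  qed
  have intB: "of_int (k * B) * (tc g / r0) \<in> \<int>" if "g \<in> carrier G" for g k
  proof -
    obtain q where "B = N2 * q" using NB unfolding dvd_def by blast
    then have "of_int (k * B) * (tc g / r0) = of_int (k * q) * (of_int N2 * (tc g / r0))" by simp
    then show ?thesis using N2(2)[OF that] by (simp only: Ints_mult Ints_of_int)
  qed
  (* the eigenvalues of the unit for k = 1 and of its inverse for k = -1 *)
  define \<epsilon> where "\<epsilon> k i = 1 + of_int (A - 1) * h i + of_int (k * B) / r0 * (d i * h i)" for k :: int and i
  have eps_reg: "spectral P Q n (\<epsilon> k) = reg (\<lambda>g. point \<one> g + of_int (A - 1) * ec g + of_int (k * B) * (tc g / r0))" for k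
  proof -
    have "spectral P Q n (\<epsilon> k) = spectral P Q n (\<lambda>i. 1 * (1 * 1 + of_int (A - 1) * h i) + (of_int (k * B) / r0) * (d i * h i))"
      by (intro eb.spectral_cong) (simp add: \<epsilon>_def)
    also have "\<dots> = 1 \<cdot>\<^sub>m (1 \<cdot>\<^sub>m reg (point \<one>) + of_int (A - 1) \<cdot>\<^sub>m reg ec) + (of_int (k * B) / r0) \<cdot>\<^sub>m reg tc"
      unfolding eb.spectral_linear eb.spectral_one reg_point_one[symmetric] ec(2)[symmetric] tc(2)[symmetric] S eb.spectral_mult ..
    also have "\<dots> = reg (\<lambda>g. point \<one> g + of_int (A - 1) * ec g + of_int (k * B) * (tc g / r0))"
      unfolding reg_linear by (rule reg_cong) simp
    finally show ?thesis .
  qed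
  have eps_int: "\<exists>u. u \<in> carrier ZG \<and> reg (coef u) = spectral P Q n (\<epsilon> k)" for k
  proof -
    have "point \<one> g + of_int (A - 1) * ec g + of_int (k * B) * (tc g / r0) \<in> \<int>" if "g \<in> carrier G" for g
      using intA[OF that] intB[OF that, of k] by (intro Ints_add) (auto simp: point_def)
    then obtain a where "a \<in> carrier ZG"
      "reg (coef a) = reg (\<lambda>g. point \<one> g + of_int (A - 1) * ec g + of_int (k * B) * (tc g / r0))"
      by (rule ZG_element_of_integral)
    then show ?thesis unfolding eps_reg by (intro exI conjI)
  qed
  have tr0: "t = 2 * (r0 * r0)" unfolding t_def r0_def by (rule dd[OF i0(1)])
  have eps_prod: "\<epsilon> k i * \<epsilon> (-k) i = 1" if "i < n" "k = 1 \<or> k = -1" for i and k :: int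
  proof (cases "d i * d i = t")
    case True
    have hi: "h i = 1" using h[OF that(1)] True by simp
    have "\<epsilon> k i * \<epsilon> (-k) i = (of_int A + of_int (k * B) / r0 * d i) * (of_int A - of_int (k * B) / r0 * d i)"
      unfolding \<epsilon>_def hi by simp
    also have "\<dots> = (of_int A)\<^sup>2 - (of_int (k * B) / r0)\<^sup>2 * (d i * d i)"
      by (simp add: power2_eq_square algebra_simps)
    also have "\<dots> = (of_int A)\<^sup>2 - 2 * (of_int (k * B))\<^sup>2"
      unfolding True tr0 using r0(2) by (simp add: power2_eq_square)
    also have "\<dots> = of_int (A\<^sup>2 - 2 * B\<^sup>2)" using that(2) by (auto simp: power_mult_distrib)
    finally show ?thesis unfolding AB by simp
  next
    case False
    then have "h i = 0" using h[OF that(1)] by simp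
    then show ?thesis by (simp add: \<epsilon>_def)
  qed
  obtain u where u: "u \<in> carrier ZG" "reg (coef u) = spectral P Q n (\<epsilon> 1)" using eps_int by blast
  obtain w where w: "w \<in> carrier ZG" "reg (coef w) = spectral P Q n (\<epsilon> (-1))" using eps_int by blast
  have prods: "reg (coef w) * reg (coef u) = 1\<^sub>m n" "reg (coef u) * reg (coef w) = 1\<^sub>m n"
    unfolding u(2) w(2) eb.spectral_mult eb.spectral_one[symmetric]
    by (intro eb.spectral_cong; use eps_prod[of _ 1] eps_prod[of _ "-1"] in simp)+
  have "reg (coef u) * reg (point g) = reg (point g) * reg (coef u)" if g: "g \<in> carrier G" for g
    unfolding u(2)
  proof (rule eb.spectral_commute[of _ d, symmetric])
    show "reg (point g) * spectral P Q n d = spectral P Q n d * reg (point g)" using comm[OF g] by (simp add: S)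
    show "\<epsilon> 1 i = \<epsilon> 1 j" if "d i = d j" for i j using that by (simp add: \<epsilon>_def h_def)
  qed simp
  then have central: "u \<in> group_centre (units_of ZG)" unfolding central_unit_iff using u(1) w(1) prods by blast
  have "u \<noteq> Poly_Mapping.single z 1 \<and> u \<noteq> - Poly_Mapping.single z 1" if z: "z \<in> carrier G" for z
  proof (rule ccontr)
    assume "\<not> ?thesis"
    then have "u = Poly_Mapping.single z 1 \<or> u = Poly_Mapping.single z (-1)" by (metis single_uminus)
    then have "\<exists>c::int. c * c = 1 \<and> u = Poly_Mapping.single z c"
    proof
      assume "u = Poly_Mapping.single z 1"
      then show ?thesis by (intro exI[of _ 1]) simp
    next
      assume "u = Poly_Mapping.single z (-1)"
      then show ?thesis by (intro exI[of _ "-1"]) simp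
    qed
    then obtain c :: int where c: "c * c = 1" "u = Poly_Mapping.single z c" by blast
    have "coef u = (\<lambda>g. of_int c * point z g)" unfolding c(2) by (rule ext) (rule coef_single)
    then have "reg (coef u) = of_int c \<cdot>\<^sub>m reg (point z)" by (intro eq_matI) (auto simp: reg_def)
    moreover have smm: "a \<cdot>\<^sub>m (b \<cdot>\<^sub>m M) = (a * b) \<cdot>\<^sub>m M" for a b and M :: "complex mat"
      by (rule eq_matI) auto
    ultimately have "reg (coef u) * reg (coef u) = (of_int c * of_int c) \<cdot>\<^sub>m (reg (point z) * reg (point z))"
      by (simp add: mult_smult_distrib[of _ n n _ n] mult_smult_assoc_mat[of _ n n _ n] smm)
    also have "of_int c * of_int c = (1::complex)" unfolding of_int_mult[symmetric] c(1) by simp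
    also have "1 \<cdot>\<^sub>m (reg (point z) * reg (point z)) = reg (point (z \<otimes> z))"
      using z reg_point_mult by (intro eq_matI) auto
    finally have sq: "reg (coef u) * reg (coef u) = reg (point (z \<otimes> z))" .
    have "spectral P Q n (\<lambda>i. (\<epsilon> 1 i * \<epsilon> 1 i) ^ 2 ^ m) = (reg (coef u) * reg (coef u)) ^\<^sub>m (2 ^ m)"
      unfolding u(2) eb.spectral_mult eb.spectral_pow ..
    also have "\<dots> = spectral P Q n (\<lambda>_. 1)"
      unfolding sq using z o[of "z \<otimes> z"] by (simp add: reg_point_pow reg_point_one eb.spectral_one)
    finally have eps_pow: "spectral P Q n (\<lambda>i. (\<epsilon> 1 i * \<epsilon> 1 i) ^ 2 ^ m) = spectral P Q n (\<lambda>_. 1)" .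
    have "(\<epsilon> 1 i0 * \<epsilon> 1 i0) ^ 2 ^ m = 1" by (rule eb.spectral_inject[OF eps_pow i0(1)])
    moreover have "\<epsilon> 1 i0 = of_real (of_int A + of_int B * sqrt 2)"
    proof -
      have "h i0 = 1" using h[OF i0(1)] by (simp add: t_def)
      moreover have "d i0 / r0 = of_real (sqrt 2)" using r(2)[OF i0(1)] r0(2) by (simp add: r0_def)
      moreover have "\<epsilon> 1 i0 = 1 + of_int (A - 1) * h i0 + of_int B * (d i0 / r0) * h i0"
        unfolding \<epsilon>_def by simp
      ultimately show ?thesis by simp
    qed
    ultimately have "(of_real (((of_int A + of_int B * sqrt 2)\<^sup>2) ^ 2 ^ m) :: complex) = of_real 1"
      by (simp add: power2_eq_square)
    then have pow1: "((of_int A + of_int B * sqrt 2)\<^sup>2) ^ 2 ^ m = (1::real)" unfolding of_real_eq_iff .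
    have "A > 1" using ab(3) by (simp add: A_def)
    have "(of_int A + of_int B * sqrt 2) * (of_int A - of_int B * sqrt 2) = (of_int (A\<^sup>2 - 2 * B\<^sup>2) :: real)"
      by (simp add: power2_eq_square algebra_simps)
    then have conj: "(of_int A + of_int B * sqrt 2) * (of_int A - of_int B * sqrt 2) = (1 :: real)"
      unfolding AB by simp
    have "((of_int A + of_int B * sqrt 2)\<^sup>2) = (1::real)"
      by (rule power_eq_imp_eq_base[of _ "2 ^ m"]) (use pow1 in simp_all)
    then have "of_int A + of_int B * sqrt 2 = 1 \<or> of_int A + of_int B * sqrt 2 = (-1::real)"
      by (simp only: power2_eq_1_iff)
    moreover have "q = p" if "p * q = 1" "p = 1 \<or> p = -1" for p q :: real using that by auto
    ultimately have "of_int A - of_int B * sqrt 2 = of_int A + of_int B * sqrt 2" using conj by blast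
    then have "of_int A + of_int B * sqrt 2 = (of_int A :: real)" by simp
    then show False
      using \<open>of_int A + of_int B * sqrt 2 = 1 \<or> of_int A + of_int B * sqrt 2 = (-1::real)\<close> \<open>A > 1\<close> by auto
  qed
  then show ?thesis using central by blast
qed

theorem real_conjugate_of_cut:
  assumes m: "m \<ge> 3" and o: "\<And>g. g \<in> carrier G \<Longrightarrow> g [^] ((2::nat) ^ m) = \<one>"
    and cut: "cut_property G" and x: "x \<in> carrier G"
  shows "real_conjugate (x [^] (3::nat)) x"
proof (rule ccontr)
  assume "\<not> ?thesis"
  from nontrivial_central_unit[OF m x o this] obtain u where "u \<in> group_centre (units_of ZG)"
    "\<forall>z\<in>carrier G. u \<noteq> Poly_Mapping.single z 1 \<and> u \<noteq> - Poly_Mapping.single z 1" by blast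
  then show False using cut unfolding cut_property_def by (auto simp: group_centre_def)
qed

end

section \<open>Quotients of the central series\<close>

context group
begin

lemma normal_of_conjugates:
  assumes "subgroup N G" "\<And>g x. g \<in> carrier G \<Longrightarrow> x \<in> N \<Longrightarrow> g \<otimes> x \<otimes> inv g \<in> N"
  shows "N \<lhd> G"
  using assms by (simp add: normal_inv_iff)

lemma rcoset_eq_iff:
  assumes H: "subgroup H G" and a: "a \<in> carrier G" and b: "b \<in> carrier G"
  shows "H #> a = H #> b \<longleftrightarrow> a \<otimes> inv b \<in> H"
proof
  assume "H #> a = H #> b"
  then have "a \<in> H #> b" using rcos_self[OF a H] by simp
  then obtain h where h: "h \<in> H" "a = h \<otimes> b" unfolding r_coset_def by blast
  then show "a \<otimes> inv b \<in> H" using b subgroup.mem_carrier[OF H] by (simp add: m_assoc)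
next
  assume "a \<otimes> inv b \<in> H"
  moreover have "a = (a \<otimes> inv b) \<otimes> b" using a b by (simp add: m_assoc)
  ultimately have "a \<in> H #> b" unfolding r_coset_def by blast
  then show "H #> a = H #> b" using repr_independence[OF _ b H] by simp
qed

text \<open>If only the identity were central, it would be the only conjugacy class of odd size, and the order of the group would be odd.\<close>

lemma centre_nontrivial_of_two_group:
  assumes fin: "finite (carrier G)" and ord: "order G dvd 2 ^ k" and nt: "order G \<noteq> 1"
  shows "\<exists>z\<in>group_centre G. z \<noteq> \<one>"
proof (rule ccontr)
  assume triv: "\<not> ?thesis"
  define \<phi> where "\<phi> g = (\<lambda>h\<in>carrier G. g \<otimes> h \<otimes> inv g)" for g
  interpret group_action G "carrier G" \<phi>
    unfolding \<phi>_def by (rule action_by_conjugation)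
  let ?O = "orbits G (carrier G) \<phi>"
  have finO: "finite ?O" using fin unfolding orbits_def by simp
  have orb_sub: "orbit G \<phi> x \<subseteq> carrier G" if "x \<in> carrier G" for x
    using that by (auto simp: orbit_def \<phi>_def)
  have one_orb: "orbit G \<phi> \<one> = {\<one>}"
    by (auto simp: orbit_def \<phi>_def intro: exI[of _ \<one>])
  have even_orb: "even (card Q)" if Q: "Q \<in> ?O" "Q \<noteq> {\<one>}" for Q
  proof -
    obtain x where x: "x \<in> carrier G" "Q = orbit G \<phi> x" using Q unfolding orbits_def by blast
    have "card Q dvd order G" using orbit_stabilizer_theorem[OF x(1)] x(2) by (metis dvd_triv_left)
    then have dvd: "card Q dvd 2 ^ k" using ord by (rule dvd_trans)
    show ?thesis
    proof (rule ccontr)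
      assume "odd (card Q)"
      then have "coprime (card Q) (2 ^ k)" by simp
      then have "card Q = 1" using coprime_common_divisor[OF _ dvd_refl dvd] by simp
      moreover have xQ: "x \<in> Q" using orbit_refl[OF x(1)] x(2) by simp
      ultimately have Qx: "Q = {x}" by (metis card_1_singletonE singletonD)
      have "x \<in> group_centre G"
        unfolding group_centre_def
      proof (intro CollectI conjI ballI x(1))
        fix g assume g: "g \<in> carrier G"
        then have "g \<otimes> x \<otimes> inv g \<in> Q" using x by (auto simp: orbit_def \<phi>_def)
        then have "g \<otimes> x \<otimes> inv g = x" using Qx by simp
        then have "g \<otimes> x \<otimes> inv g \<otimes> g = x \<otimes> g" by simp
        then show "x \<otimes> g = g \<otimes> x" using g x(1) by (simp add: m_assoc)
      qed
      then have "x = \<one>" using triv by blast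
      then show False using Q(2) Qx by simp
    qed
  qed
  have oneO: "{\<one>} \<in> ?O" using one_orb unfolding orbits_def by (metis (mono_tags, lifting) CollectI one_closed)
  have "order G = (\<Sum>x\<in>carrier G. 1)" by (simp add: Coset.order_def)
  also have "\<dots> = (\<Sum>Q\<in>?O. \<Sum>x\<in>Q. 1)" by (rule disjoint_sum[OF fin, symmetric])
  also have "\<dots> = (\<Sum>Q\<in>?O. card Q)" by simp
  also have "\<dots> = 1 + (\<Sum>Q\<in>?O - {{\<one>}}. card Q)"
    using finO oneO by (simp add: sum.remove)
  finally have "order G = 1 + (\<Sum>Q\<in>?O - {{\<one>}}. card Q)" .
  moreover have "even (\<Sum>Q\<in>?O - {{\<one>}}. card Q)" by (rule dvd_sum) (use even_orb in auto)
  ultimately have "odd (order G)" by simp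
  then have "coprime (order G) (2 ^ k)" by simp
  then show False using coprime_common_divisor[OF _ dvd_refl ord] nt by simp
qed

text \<open>Coset-free description of the next term: all commutators with \<open>x\<close> fall into the present one.\<close>

lemma upper_central_Suc_iff:
  assumes N: "upper_central G i \<lhd> G"
  shows "x \<in> upper_central G (Suc i) \<longleftrightarrow>
    x \<in> carrier G \<and> (\<forall>g\<in>carrier G. x \<otimes> g \<otimes> inv x \<otimes> inv g \<in> upper_central G i)"
proof -
  let ?U = "upper_central G i"
  have sub: "subgroup ?U G" using N by (rule normal_imp_subgroup)
  have "?U #> x \<in> group_centre (G Mod ?U) \<longleftrightarrow> (\<forall>g\<in>carrier G. x \<otimes> g \<otimes> inv x \<otimes> inv g \<in> ?U)"
    if x: "x \<in> carrier G"
  proof -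
    have "(?U #> x) <#> (?U #> g) = (?U #> g) <#> (?U #> x) \<longleftrightarrow> x \<otimes> g \<otimes> inv x \<otimes> inv g \<in> ?U"
      if g: "g \<in> carrier G" for g
      using x g by (simp add: normal.rcos_sum[OF N] rcoset_eq_iff[OF sub] inv_mult_group m_assoc)
    then show ?thesis
      using x unfolding group_centre_def by (simp add: carrier_FactGroup)
  qed
  then show ?thesis by auto
qed

lemma normal_upper_central: "upper_central G i \<lhd> G"
proof (induction i)
  case 0
  show ?case by (simp add: one_is_normal)
next
  case (Suc i)
  let ?U = "upper_central G i"
  interpret U: normal ?U G by (rule Suc)
  note iff = upper_central_Suc_iff[OF Suc]
  have comm_inv: "g \<otimes> x \<otimes> inv g \<otimes> inv x \<in> ?U" if "x \<in> upper_central G (Suc i)" "g \<in> carrier G" for x g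
  proof -
    have x: "x \<in> carrier G" "x \<otimes> g \<otimes> inv x \<otimes> inv g \<in> ?U" using that iff by blast+
    have "g \<otimes> x \<otimes> inv g \<otimes> inv x = inv (x \<otimes> g \<otimes> inv x \<otimes> inv g)"
      using x(1) that(2) by (simp add: inv_mult_group m_assoc)
    then show ?thesis using U.m_inv_closed[OF x(2)] by simp
  qed
  have sub: "?U \<subseteq> upper_central G (Suc i)"
  proof
    fix x assume x: "x \<in> ?U"
    then have xc: "x \<in> carrier G" by simp
    show "x \<in> upper_central G (Suc i)" unfolding iff
    proof (intro conjI ballI xc)
      fix g assume g: "g \<in> carrier G"
      have "x \<otimes> (g \<otimes> inv x \<otimes> inv g) \<in> ?U" using U.inv_op_closed2[OF g] x by simp
      then show "x \<otimes> g \<otimes> inv x \<otimes> inv g \<in> ?U" using g xc by (simp add: m_assoc)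
    qed
  qed
  have coset: "y \<in> upper_central G (Suc i)" if "x \<in> upper_central G (Suc i)" "y \<in> carrier G" "y \<otimes> inv x \<in> ?U" for x y
  proof -
    have "x \<in> carrier G" using that(1) iff by blast
    then have "?U #> y = ?U #> x" using rcoset_eq_iff[OF U.subgroup_axioms] that by blast
    then show ?thesis using that(1,2) by simp
  qed
  show ?case
  proof (rule normal_of_conjugates)
    show "subgroup (upper_central G (Suc i)) G"
    proof (rule subgroupI)
      show "upper_central G (Suc i) \<subseteq> carrier G" by auto
      show "upper_central G (Suc i) \<noteq> {}" using sub U.one_closed by blast
    next
      fix x assume x: "x \<in> upper_central G (Suc i)"
      have xc: "x \<in> carrier G" using x iff by blast
      show "inv x \<in> upper_central G (Suc i)" unfolding iff
      proof (intro conjI ballI)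
        fix g assume g: "g \<in> carrier G"
        have "inv x \<otimes> (g \<otimes> x \<otimes> inv g \<otimes> inv x) \<otimes> x \<in> ?U"
          using U.inv_op_closed1[OF xc comm_inv[OF x g]] by simp
        then show "inv x \<otimes> g \<otimes> inv (inv x) \<otimes> inv g \<in> ?U" using xc g by (simp add: m_assoc)
      qed (use xc in simp)
    next
      fix x y assume x: "x \<in> upper_central G (Suc i)" and y: "y \<in> upper_central G (Suc i)"
      have xc: "x \<in> carrier G" and yc: "y \<in> carrier G" using x y iff by blast+
      show "x \<otimes> y \<in> upper_central G (Suc i)" unfolding iff
      proof (intro conjI ballI)
        fix g assume g: "g \<in> carrier G"
        have 1: "x \<otimes> (y \<otimes> g \<otimes> inv y \<otimes> inv g) \<otimes> inv x \<in> ?U"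
          using U.inv_op_closed2[OF xc] y g iff by blast
        have 2: "x \<otimes> g \<otimes> inv x \<otimes> inv g \<in> ?U" using x g iff by blast
        have "(x \<otimes> (y \<otimes> g \<otimes> inv y \<otimes> inv g) \<otimes> inv x) \<otimes> (x \<otimes> g \<otimes> inv x \<otimes> inv g) \<in> ?U"
          by (rule U.m_closed[OF 1 2])
        then show "x \<otimes> y \<otimes> g \<otimes> inv (x \<otimes> y) \<otimes> inv g \<in> ?U"
          using xc yc g by (simp add: m_assoc inv_mult_group inv_cancel)
      qed (use xc yc in simp)
    qed
    fix g x assume g: "g \<in> carrier G" and x: "x \<in> upper_central G (Suc i)"
    have xc: "x \<in> carrier G" using x iff by blast
    show "g \<otimes> x \<otimes> inv g \<in> upper_central G (Suc i)"
      by (rule coset[OF x _ comm_inv[OF x g]]) (use g xc in simp)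
  qed
qed

lemma upper_central_mono: "upper_central G i \<subseteq> upper_central G (Suc i)"
proof
  interpret U: normal "upper_central G i" G by (rule normal_upper_central)
  fix x assume x: "x \<in> upper_central G i"
  then have xc: "x \<in> carrier G" by simp
  show "x \<in> upper_central G (Suc i)" unfolding upper_central_Suc_iff[OF normal_upper_central]
  proof (intro conjI ballI xc)
    fix g assume g: "g \<in> carrier G"
    have "x \<otimes> (g \<otimes> inv x \<otimes> inv g) \<in> upper_central G i" using U.inv_op_closed2[OF g] x by simp
    then show "x \<otimes> g \<otimes> inv x \<otimes> inv g \<in> upper_central G i" using g xc by (simp add: m_assoc)
  qed
qed

text \<open>Applies the nontriviality of the centre to the factor group, again a 2-group.\<close>

lemma upper_central_strict:
  assumes fin: "finite (carrier G)" and ord: "order G dvd 2 ^ k" and ne: "upper_central G i \<noteq> carrier G"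
  shows "upper_central G i \<subset> upper_central G (Suc i)"
proof -
  let ?U = "upper_central G i"
  interpret U: normal ?U G by (rule normal_upper_central)
  interpret Q: group "G Mod ?U" by (rule U.factorgroup_is_group)
  have lag: "card (rcosets ?U) * card ?U = order G" by (rule lagrange[OF U.subgroup_axioms])
  have oQ: "order (G Mod ?U) = card (rcosets ?U)" by (simp add: Coset.order_def FactGroup_def)
  have "order (G Mod ?U) dvd 2 ^ k" unfolding oQ using lag ord by (metis dvd_trans dvd_triv_left)
  moreover have "finite (carrier (G Mod ?U))" using fin by (simp add: carrier_FactGroup)
  moreover have "order (G Mod ?U) \<noteq> 1"
  proof
    assume "order (G Mod ?U) = 1"
    then have one: "card (rcosets ?U) = 1" unfolding oQ .
    have "card ?U = card (carrier G)" using lag unfolding one Coset.order_def by simp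
    then show False using card_subset_eq[OF fin U.subset] ne by simp
  qed
  ultimately obtain z where z: "z \<in> group_centre (G Mod ?U)" "z \<noteq> \<one>\<^bsub>G Mod ?U\<^esub>"
    using Q.centre_nontrivial_of_two_group by blast
  then obtain x where x: "x \<in> carrier G" "z = ?U #> x" by (auto simp: group_centre_def carrier_FactGroup)
  have "x \<in> upper_central G (Suc i)" using x z(1) by simp
  moreover have "x \<notin> ?U" using z(2) x U.rcos_const by auto
  ultimately show ?thesis using upper_central_mono by blast
qed

lemma upper_central_reaches_top:
  assumes fin: "finite (carrier G)" and ord: "order G dvd 2 ^ k"
  shows "\<exists>i. upper_central G i = carrier G"
proof (rule ccontr)
  assume no: "\<not> ?thesis"
  have fU: "finite (upper_central G i)" for i
    using fin normal_imp_subgroup[OF normal_upper_central] subgroup.subset finite_subset by metis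
  have "i < card (upper_central G i)" for i
  proof (induction i)
    case (Suc i)
    have "card (upper_central G i) < card (upper_central G (Suc i))"
      by (rule psubset_card_mono[OF fU upper_central_strict[OF fin ord]]) (use no in blast)
    then show ?case using Suc by linarith
  qed simp
  from this[of "card (carrier G)"] show False
    using card_mono[OF fin] normal_imp_subgroup[OF normal_upper_central] subgroup.subset by (meson not_less)
qed

lemma lower_central_commutator:
  assumes "x \<in> lower_central G i" "g \<in> carrier G"
  shows "x \<otimes> g \<otimes> inv x \<otimes> inv g \<in> lower_central G (Suc i)"
  using assms unfolding lower_central.simps commutator_subgroup_def by (blast intro: generate.incl)

lemma lower_central_normal_mono:
  "lower_central G i \<lhd> G \<and> lower_central G (Suc i) \<subseteq> lower_central G i"
proof (induction i)
  have step: "lower_central G (Suc i) \<subseteq> lower_central G i" if "lower_central G i \<lhd> G" for i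
  proof -
    interpret N: normal "lower_central G i" G by (rule that)
    have "h \<otimes> k \<otimes> inv h \<otimes> inv k \<in> lower_central G i" if "h \<in> lower_central G i" "k \<in> carrier G" for h k
    proof -
      have "h \<otimes> (k \<otimes> inv h \<otimes> inv k) \<in> lower_central G i" using N.inv_op_closed2[OF that(2)] that(1) by simp
      then show ?thesis using that N.subset by (simp add: m_assoc subsetD)
    qed
    then show ?thesis
      unfolding lower_central.simps(2) commutator_subgroup_def
      by (intro generate_subgroup_incl N.subgroup_axioms) blast
  qed
  {
    case 0
    have "lower_central G 0 \<lhd> G" by (simp add: normal_of_conjugates subgroup_self)
    then show ?case using step by blast
  next
    case (Suc i)
    interpret N: normal "lower_central G i" G using Suc by blast
    have "lower_central G (Suc i) \<lhd> G"
    proof (rule normal_of_conjugates)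
      show sg: "subgroup (lower_central G (Suc i)) G"
        unfolding lower_central.simps(2) commutator_subgroup_def
        by (rule generate_is_subgroup) (use N.subset in auto)
      fix g x assume g: "g \<in> carrier G" and x: "x \<in> lower_central G (Suc i)"
      then have xi: "x \<in> lower_central G i" and xc: "x \<in> carrier G" using Suc N.subset by auto
      have "inv (x \<otimes> g \<otimes> inv x \<otimes> inv g) \<otimes> x \<in> lower_central G (Suc i)"
        using lower_central_commutator[OF xi g] x subgroup.m_closed[OF sg] subgroup.m_inv_closed[OF sg] by blast
      then show "g \<otimes> x \<otimes> inv g \<in> lower_central G (Suc i)" using g xc by (simp add: inv_mult_group m_assoc)
    qed
    then show ?case using step by blast
  }
qed

text \<open>If \<open>M = [M, G]\<close>, then \<open>M\<close> lying in a term of the upper central series implies that it lies in the previous one. As the upper central series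
  reaches \<open>G\<close>, it follows that \<open>M\<close> is trivial.\<close>

lemma lower_central_strict:
  assumes fin: "finite (carrier G)" and ord: "order G dvd 2 ^ k" and ne: "lower_central G i \<noteq> {\<one>}"
  shows "lower_central G (Suc i) \<noteq> lower_central G i"
proof
  assume eq: "lower_central G (Suc i) = lower_central G i"
  interpret N: normal "lower_central G i" G using lower_central_normal_mono by blast
  obtain j where j: "upper_central G j = carrier G" using upper_central_reaches_top[OF fin ord] by blast
  have "lower_central G i \<subseteq> upper_central G j \<Longrightarrow> lower_central G i = {\<one>}" for j
  proof (induction j)
    case 0
    then show ?case using N.one_closed by auto
  next
    case (Suc j)
    interpret U: normal "upper_central G j" G by (rule normal_upper_central)
    have "lower_central G (Suc i) \<subseteq> upper_central G j"
      unfolding lower_central.simps(2) commutator_subgroup_def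
      by (intro generate_subgroup_incl U.subgroup_axioms)
        (use Suc.prems upper_central_Suc_iff[OF normal_upper_central] in blast)
    then show ?case using Suc.IH eq by simp
  qed
  from this[of j] show False using j ne N.subset by blast
qed

text \<open>Modulo \<open>N\<close>, conjugation fixes \<open>x\<close> and its inverse, so \<open>x\<^sup>3\<close> is congruent to \<open>x\<close> or to \<open>x\<^sup>-\<^sup>1\<close>: either \<open>x\<^sup>2\<close> or
  \<open>x\<^sup>4\<close> lies in \<open>N\<close>.\<close>

lemma fourth_power_of_real_conjugate_cube:
  assumes N: "subgroup N G" and x: "x \<in> carrier G"
    and comm: "\<And>h. h \<in> carrier G \<Longrightarrow> x \<otimes> h \<otimes> inv x \<otimes> inv h \<in> N" "\<And>h. h \<in> carrier G \<Longrightarrow> inv x \<otimes> h \<otimes> x \<otimes> inv h \<in> N"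
    and r: "real_conjugate (x [^] (3::nat)) x"
  shows "x [^] (4::nat) \<in> N"
proof -
  interpret N: subgroup N G by (rule N)
  have p: "x [^] (3::nat) = x \<otimes> x \<otimes> x" "x [^] (4::nat) = x \<otimes> x \<otimes> x \<otimes> x"
    using x by (simp_all add: numeral_eq_Suc)
  have x3: "x [^] (3::nat) \<in> carrier G" using x by simp
  from r show ?thesis unfolding real_conjugate_def
  proof
    assume "conjugate_in G (x [^] (3::nat)) x"
    from conjugate_in_sym[OF this x3] obtain h where h: "h \<in> carrier G" "x [^] (3::nat) = h \<otimes> x \<otimes> inv h"
      unfolding conjugate_in_def by blast
    have "inv (x \<otimes> h \<otimes> inv x \<otimes> inv h) = (h \<otimes> x \<otimes> inv h) \<otimes> inv x"
      using h(1) x by (simp add: inv_mult_group m_assoc)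
    also have "\<dots> = x \<otimes> x" unfolding h(2)[symmetric] p using x by (simp add: m_assoc)
    finally have "x \<otimes> x \<in> N" using N.m_inv_closed[OF comm(1)[OF h(1)]] by simp
    then have "(x \<otimes> x) \<otimes> (x \<otimes> x) \<in> N" by simp
    then show ?thesis unfolding p using x by (simp add: m_assoc)
  next
    assume "conjugate_in G (x [^] (3::nat)) (inv x)"
    from conjugate_in_sym[OF this x3] obtain h where h: "h \<in> carrier G" "x [^] (3::nat) = h \<otimes> inv x \<otimes> inv h"
      unfolding conjugate_in_def by blast
    have "inv (inv x \<otimes> h \<otimes> x \<otimes> inv h) = (h \<otimes> inv x \<otimes> inv h) \<otimes> x"
      using h(1) x by (simp add: inv_mult_group m_assoc)
    also have "\<dots> = x \<otimes> x \<otimes> x \<otimes> x" unfolding h(2)[symmetric] p ..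
    finally show ?thesis using N.m_inv_closed[OF comm(2)[OF h(1)]] unfolding p by simp
  qed
qed

end

text \<open>The exponent divides 4 and is not 1 because the quotient is nontrivial. As it is defined as a least number, 3 has to be excluded as well: \<open>z\<^sup>3 = z\<^sup>4 = 1\<close> would give \<open>z = 1\<close>.\<close>

lemma group_exponent_quotient:
  assumes N: "N \<lhd> K" and fourth: "\<And>x. x \<in> carrier K \<Longrightarrow> x [^]\<^bsub>K\<^esub> (4::nat) \<in> N" and ne: "N \<noteq> carrier K"
  shows "group_exponent (K Mod N) \<in> {2, 4}"
proof -
  interpret N: normal N K by (rule N)
  interpret Q: group "K Mod N" by (rule N.factorgroup_is_group)
  define P where "P m \<longleftrightarrow> 0 < m \<and> (\<forall>x \<in> carrier (K Mod N). x [^]\<^bsub>K Mod N\<^esub> m = \<one>\<^bsub>K Mod N\<^esub>)" for m :: nat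
  have P4: "P 4"
    unfolding P_def
  proof (intro conjI ballI)
    fix z assume "z \<in> carrier (K Mod N)"
    then obtain x where x: "x \<in> carrier K" "z = N #>\<^bsub>K\<^esub> x" by (auto simp: carrier_FactGroup)
    show "z [^]\<^bsub>K Mod N\<^esub> (4::nat) = \<one>\<^bsub>K Mod N\<^esub>"
      unfolding x(2) N.FactGroup_pow[OF x(1)] using N.rcos_const[OF N.is_group fourth[OF x(1)]] by simp
  qed simp
  obtain x where x: "x \<in> carrier K" "x \<notin> N" using ne N.subset by blast
  define z where "z = N #>\<^bsub>K\<^esub> x"
  have z: "z \<in> carrier (K Mod N)" using x(1) by (auto simp: z_def carrier_FactGroup)
  have z1: "z \<noteq> \<one>\<^bsub>K Mod N\<^esub>"
    using N.rcos_self[OF x(1) N.subgroup_axioms] x(2) by (auto simp: z_def)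
  have not1: "\<not> P 1"
  proof
    assume "P 1"
    then have "z [^]\<^bsub>K Mod N\<^esub> (1::nat) = \<one>\<^bsub>K Mod N\<^esub>" using z unfolding P_def by blast
    then show False using z1 unfolding Q.nat_pow_eone[OF z] by blast
  qed
  have not3: "\<not> P 3"
  proof
    assume "P 3"
    then have 3: "z [^]\<^bsub>K Mod N\<^esub> (3::nat) = \<one>\<^bsub>K Mod N\<^esub>" using z unfolding P_def by blast
    have 4: "z [^]\<^bsub>K Mod N\<^esub> (4::nat) = \<one>\<^bsub>K Mod N\<^esub>" using P4 z unfolding P_def by blast
    have "z [^]\<^bsub>K Mod N\<^esub> (4::nat) = z [^]\<^bsub>K Mod N\<^esub> (Suc 3)" by simp
    also have "\<dots> = z [^]\<^bsub>K Mod N\<^esub> (3::nat) \<otimes>\<^bsub>K Mod N\<^esub> z" by (rule Q.nat_pow_Suc)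
    also have "\<dots> = z" unfolding 3 by (rule Q.l_one[OF z])
    finally show False using 4 z1 by metis
  qed
  have eq: "group_exponent (K Mod N) = (LEAST m. P m)"
    unfolding group_exponent_def Let_def P_def[symmetric] using P4 by auto
  have L: "P (LEAST m. P m)" by (rule LeastI[of P, OF P4])
  have "(LEAST m. P m) \<le> 4" by (rule Least_le[of P, OF P4])
  moreover have "(LEAST m. P m) \<noteq> 0" using L by (simp add: P_def)
  moreover have "(LEAST m. P m) \<noteq> 1" "(LEAST m. P m) \<noteq> 3" using L not1 not3 by metis+
  ultimately show ?thesis unfolding eq by auto
qed

context group
begin

lemma lower_central_exponent:
  assumes fin: "finite (carrier G)" and ord: "order G dvd 2 ^ k"
    and r: "\<And>x. x \<in> carrier G \<Longrightarrow> real_conjugate (x [^] (3::nat)) x"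
    and ne: "lower_central G i \<noteq> {\<one>}"
  shows "group_exponent ((G\<lparr>carrier := lower_central G i\<rparr>) Mod lower_central G (Suc i)) \<in> {2, 4}"
proof (rule group_exponent_quotient)
  interpret N: normal "lower_central G i" G using lower_central_normal_mono by blast
  have N1: "lower_central G (Suc i) \<lhd> G" and mono: "lower_central G (Suc i) \<subseteq> lower_central G i"
    using lower_central_normal_mono by blast+
  show "lower_central G (Suc i) \<lhd> G\<lparr>carrier := lower_central G i\<rparr>"
    by (rule normal_restrict_supergroup[OF N.subgroup_axioms N1 mono])
  show "lower_central G (Suc i) \<noteq> carrier (G\<lparr>carrier := lower_central G i\<rparr>)"
    using lower_central_strict[OF fin ord ne] by simp
  fix x assume "x \<in> carrier (G\<lparr>carrier := lower_central G i\<rparr>)"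
  then have x: "x \<in> lower_central G i" by simp
  then have xc: "x \<in> carrier G" by simp
  have "x [^] (4::nat) \<in> lower_central G (Suc i)"
  proof (rule fourth_power_of_real_conjugate_cube[OF normal_imp_subgroup[OF N1] xc _ _ r[OF xc]])
    fix h assume h: "h \<in> carrier G"
    show "x \<otimes> h \<otimes> inv x \<otimes> inv h \<in> lower_central G (Suc i)" by (rule lower_central_commutator[OF x h])
    show "inv x \<otimes> h \<otimes> x \<otimes> inv h \<in> lower_central G (Suc i)"
      using lower_central_commutator[OF N.m_inv_closed[OF x] h] xc by simp
  qed
  then show "x [^]\<^bsub>G\<lparr>carrier := lower_central G i\<rparr>\<^esub> (4::nat) \<in> lower_central G (Suc i)"
    unfolding nat_pow_consistent[symmetric] .
qed

lemma upper_central_exponent: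
  assumes fin: "finite (carrier G)" and ord: "order G dvd 2 ^ k"
    and r: "\<And>x. x \<in> carrier G \<Longrightarrow> real_conjugate (x [^] (3::nat)) x"
    and ne: "upper_central G i \<noteq> carrier G"
  shows "group_exponent ((G\<lparr>carrier := upper_central G (Suc i)\<rparr>) Mod upper_central G i) \<in> {2, 4}"
proof (rule group_exponent_quotient)
  interpret N: normal "upper_central G (Suc i)" G by (rule normal_upper_central)
  note iff = upper_central_Suc_iff[OF normal_upper_central]
  have carrier_restrict: "carrier (G\<lparr>carrier := S\<rparr>) = S" for S by simp
  show "upper_central G i \<lhd> G\<lparr>carrier := upper_central G (Suc i)\<rparr>"
    by (rule normal_restrict_supergroup[OF N.subgroup_axioms normal_upper_central upper_central_mono])
  show "upper_central G i \<noteq> carrier (G\<lparr>carrier := upper_central G (Suc i)\<rparr>)"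
    unfolding carrier_restrict using upper_central_strict[OF fin ord ne] unfolding psubset_eq by (rule conjunct2)
  fix x assume "x \<in> carrier (G\<lparr>carrier := upper_central G (Suc i)\<rparr>)"
  then have x: "x \<in> upper_central G (Suc i)" unfolding carrier_restrict .
  then have xc: "x \<in> carrier G" by (rule N.mem_carrier)
  have "x [^] (4::nat) \<in> upper_central G i"
  proof (rule fourth_power_of_real_conjugate_cube[OF normal_imp_subgroup[OF normal_upper_central] xc _ _ r[OF xc]])
    fix h assume h: "h \<in> carrier G"
    show "x \<otimes> h \<otimes> inv x \<otimes> inv h \<in> upper_central G i"
      using iff[THEN iffD1, OF x] h by blast
    have "inv x \<otimes> h \<otimes> inv (inv x) \<otimes> inv h \<in> upper_central G i"
      using iff[THEN iffD1, OF N.m_inv_closed[OF x]] h by blast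
    then show "inv x \<otimes> h \<otimes> x \<otimes> inv h \<in> upper_central G i" unfolding inv_inv[OF xc] .
  qed
  then show "x [^]\<^bsub>G\<lparr>carrier := upper_central G (Suc i)\<rparr>\<^esub> (4::nat) \<in> upper_central G i"
    unfolding nat_pow_consistent[symmetric] .
qed

end

section \<open>The cut-property of 2-groups\<close>

theorem theorem3:
  fixes G (structure)
  assumes "group G"
    and "finite (carrier G)"
    and "\<exists>n::nat. order G = 2 ^ n"
  shows "(cut_property G \<longleftrightarrow>
      (\<forall>x \<in> carrier G.
        conjugate_in G (x [^] (3::nat)) x \<or> conjugate_in G (x [^] (3::nat)) (inv x)))
    \<and> (cut_property G \<longrightarrow>
      (\<forall>i. lower_central G i \<noteq> {\<one>} \<longrightarrow>
        group_exponent ((G\<lparr>carrier := lower_central G i\<rparr>) Mod lower_central G (Suc i)) \<in> {2, 4})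
      \<and> (\<forall>i. upper_central G i \<noteq> carrier G \<longrightarrow>
        group_exponent ((G\<lparr>carrier := upper_central G (Suc i)\<rparr>) Mod upper_central G i) \<in> {2, 4}))"
proof -
  interpret group G by (rule assms(1))
  obtain k where k: "order G = 2 ^ k" using assms(3) by blast
  (* the exponent need not be exact, but the sums weighted by theta need 8 dvd 2 ^ m *)
  define m where "m = k + 3"
  have o: "g [^] ((2::nat) ^ m) = \<one>" if g: "g \<in> carrier G" for g
    by (rule pow_eq_one_of_dvd[OF g pow_order_eq_1[OF g]]) (simp add: k m_def power_add)
  obtain enum where "bij_betw enum {0..<card (carrier G)} (carrier G)"
    using ex_bij_betw_nat_finite[OF assms(2)] by blast
  then interpret enumerated_group G enum "card (carrier G)"
    by unfold_locales (simp add: atLeast0LessThan)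
  have iff: "cut_property G \<longleftrightarrow> (\<forall>x\<in>carrier G. real_conjugate (x [^] (3::nat)) x)"
    using real_conjugate_of_cut[OF _ o] cut_of_real_conjugate[OF _ o] by (auto simp: m_def)
  have ord: "order G dvd 2 ^ k" by (simp add: k)
  show ?thesis
    using iff lower_central_exponent[OF assms(2) ord] upper_central_exponent[OF assms(2) ord]
    unfolding real_conjugate_def[symmetric] by blast
qed

end
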